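(* Let $M$ be a compact two-dimensional smooth manifold and let $f\in C^1(M)$ be a robustly transitive map with persistent critical set. Then: (1) For every $C^1$-neighborhood $\mathcal{U}$ of $f$ there exist $g\in\mathcal{U}$ and a critical point $x_0\in S_g$ of $g$ such that the forward orbit $\{g^n(x_0):n\geq 0\}$ is dense in $M$. (2) $Df_p$ is not the zero linear map for every $p\in S_f$.
   Context: $C^1(M)$ is the space of $C^1$ maps $M\to M$ (not necessarily invertible) with the $C^1$ topology. For $g\in C^1(M)$, the critical set is $S_g=\{p\in M: Dg_p\text{ is not invertible}\}$. A map is transitive if it has a point with dense forward orbit; $f$ is robustly transitive if there is a $C^1$-neighborhood of $f$ all of whose elements are transitive. The critical set of $f$ is persistent if there is a $C^1$-neighborhood of $f$ such that every map $g$ in it has $S_g\neq\emptyset$. *)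

theory Defs
  imports "HOL-Analysis.Analysis"
begin

subsection \<open>Maps of class \<open>C\<^sup>k\<close> on an open subset of a Euclidean space\<close>

text \<open>Only meant for open \<open>S\<close>: derivatives are full derivatives \<open>at x\<close>. Continuity of the
  derivative is expressed direction by direction, which in finite dimension is the same as
  continuity in the operator norm.\<close>

primrec Ck_on :: "nat \<Rightarrow> 'e::euclidean_space set \<Rightarrow> ('e \<Rightarrow> 'e) \<Rightarrow> bool" where
  "Ck_on 0 S f \<longleftrightarrow> continuous_on S f"
| "Ck_on (Suc k) S f \<longleftrightarrow>
     (\<forall>x\<in>S. f differentiable (at x)) \<and> (\<forall>v. Ck_on k S (\<lambda>x. frechet_derivative f (at x) v))"

definition smooth_on :: "'e::euclidean_space set \<Rightarrow> ('e \<Rightarrow> 'e) \<Rightarrow> bool" where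
  "smooth_on S f \<longleftrightarrow> (\<forall>k. Ck_on k S f)"


subsection \<open>Smooth manifolds\<close>

text \<open>A chart is a pair of its domain and its coordinate map; the values of the coordinate map
  outside the domain are irrelevant. The manifold is the whole type \<open>'a\<close>, it has no boundary, and
  its dimension is that of the Euclidean space \<open>'e\<close>.\<close>

type_synonym ('a, 'e) chart = "'a set \<times> ('a \<Rightarrow> 'e)"

abbreviation chart_dom :: "('a, 'e) chart \<Rightarrow> 'a set" where
  "chart_dom c \<equiv> fst c"

abbreviation chart_map :: "('a, 'e) chart \<Rightarrow> 'a \<Rightarrow> 'e" where
  "chart_map c \<equiv> snd c"

definition chart_inv :: "('a, 'e) chart \<Rightarrow> 'e \<Rightarrow> 'a" where
  "chart_inv c = inv_into (chart_dom c) (chart_map c)"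

definition is_chart :: "('a::topological_space, 'e::euclidean_space) chart \<Rightarrow> bool" where
  "is_chart c \<longleftrightarrow> open (chart_dom c) \<and> open (chart_map c ` chart_dom c) \<and>
     homeomorphism (chart_dom c) (chart_map c ` chart_dom c) (chart_map c) (chart_inv c)"

text \<open>The smooth structure is given by an arbitrary smooth atlas, not necessarily a maximal
  one; the notions below depend only on the maximal atlas it generates.\<close>

locale smooth_manifold =
  fixes A :: "('a::{t2_space, second_countable_topology}, 'e::euclidean_space) chart set"
  assumes charts: "c \<in> A \<Longrightarrow> is_chart c"
    and cover: "(\<Union>c\<in>A. chart_dom c) = UNIV"
    and compatible: "c \<in> A \<Longrightarrow> d \<in> A \<Longrightarrow>
      smooth_on (chart_map c ` (chart_dom c \<inter> chart_dom d)) (chart_map d \<circ> chart_inv c)"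


subsection \<open>\<open>C\<^sup>1\<close> maps and the \<open>C\<^sup>1\<close> topology\<close>

definition local_rep :: "('a, 'e) chart \<Rightarrow> ('a, 'e) chart \<Rightarrow> ('a \<Rightarrow> 'a) \<Rightarrow> 'e \<Rightarrow> 'e" where
  "local_rep c d f = chart_map d \<circ> f \<circ> chart_inv c"

definition C1_maps ::
  "('a::topological_space, 'e::euclidean_space) chart set \<Rightarrow> ('a \<Rightarrow> 'a) set" where
  "C1_maps A = {f. continuous_on UNIV f \<and>
     (\<forall>c\<in>A. \<forall>d\<in>A. Ck_on 1 (chart_map c ` (chart_dom c \<inter> f -` chart_dom d)) (local_rep c d f))}"

text \<open>The usual subbasis of the \<open>C\<^sup>1\<close> topology: closeness to \<open>f\<close> of the coordinate
  representation and of its derivative, uniformly on a compact subset \<open>K\<close> of a chart domain. On a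
  compact manifold this weak topology agrees with the strong one.\<close>

definition C1_subbasic ::
  "('a::topological_space, 'e::euclidean_space) chart set \<Rightarrow> ('a \<Rightarrow> 'a) \<Rightarrow>
   ('a, 'e) chart \<Rightarrow> ('a, 'e) chart \<Rightarrow> 'a set \<Rightarrow> real \<Rightarrow> ('a \<Rightarrow> 'a) set" where
  "C1_subbasic A f c d K \<epsilon> = {g \<in> C1_maps A. g ` K \<subseteq> chart_dom d \<and>
     (\<forall>x \<in> chart_map c ` K.
        norm (local_rep c d g x - local_rep c d f x) < \<epsilon> \<and>
        onorm (\<lambda>v. frechet_derivative (local_rep c d g) (at x) v
                 - frechet_derivative (local_rep c d f) (at x) v) < \<epsilon>)}"

definition C1_topology ::
  "('a::topological_space, 'e::euclidean_space) chart set \<Rightarrow> ('a \<Rightarrow> 'a) topology" where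
  "C1_topology A = topology_generated_by
     {C1_subbasic A f c d K \<epsilon> | f c d K \<epsilon>. f \<in> C1_maps A \<and> c \<in> A \<and> d \<in> A \<and>
        compact K \<and> K \<subseteq> chart_dom c \<and> f ` K \<subseteq> chart_dom d \<and> 0 < \<epsilon>}"

definition C1_neighborhood ::
  "('a::topological_space, 'e::euclidean_space) chart set \<Rightarrow> ('a \<Rightarrow> 'a) \<Rightarrow> ('a \<Rightarrow> 'a) set \<Rightarrow> bool"
  where
  "C1_neighborhood A f \<U> \<longleftrightarrow> \<U> \<subseteq> C1_maps A \<and> (\<exists>W. openin (C1_topology A) W \<and> f \<in> W \<and> W \<subseteq> \<U>)"


subsection \<open>Tangent spaces, differentials and critical points\<close>

text \<open>A tangent vector at \<open>p\<close> is given by its coordinates in all charts around \<open>p\<close>, related by the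
  derivatives of the coordinate changes; it is set to zero on all other index values, so that
  \<open>\<lambda>_. 0\<close> is the zero vector of every tangent space.\<close>

definition charts_at :: "('a, 'e) chart set \<Rightarrow> 'a \<Rightarrow> ('a, 'e) chart set" where
  "charts_at A p = {c \<in> A. p \<in> chart_dom c}"

definition tangent_space ::
  "('a, 'e::euclidean_space) chart set \<Rightarrow> 'a \<Rightarrow> (('a, 'e) chart \<Rightarrow> 'e) set" where
  "tangent_space A p = {\<xi>. (\<forall>c. c \<notin> charts_at A p \<longrightarrow> \<xi> c = 0) \<and>
     (\<forall>c \<in> charts_at A p. \<forall>d \<in> charts_at A p.
        \<xi> d = frechet_derivative (chart_map d \<circ> chart_inv c) (at (chart_map c p)) (\<xi> c))}"

text \<open>The choice of the chart \<open>c\<close> is immaterial by the chain rule, see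
  \<open>differential_eq\<close> below.\<close>

definition differential ::
  "('a, 'e::euclidean_space) chart set \<Rightarrow> ('a \<Rightarrow> 'a) \<Rightarrow> 'a \<Rightarrow>
   (('a, 'e) chart \<Rightarrow> 'e) \<Rightarrow> (('a, 'e) chart \<Rightarrow> 'e)" where
  "differential A g p \<xi> = (\<lambda>d.
     if d \<in> charts_at A (g p)
     then let c = (SOME c. c \<in> charts_at A p)
          in frechet_derivative (local_rep c d g) (at (chart_map c p)) (\<xi> c)
     else 0)"

definition critical_set ::
  "('a, 'e::euclidean_space) chart set \<Rightarrow> ('a \<Rightarrow> 'a) \<Rightarrow> 'a set" where
  "critical_set A g =
     {p. \<not> bij_betw (differential A g p) (tangent_space A p) (tangent_space A (g p))}"


subsection \<open>Dynamics\<close>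

definition forward_orbit :: "('a \<Rightarrow> 'a) \<Rightarrow> 'a \<Rightarrow> 'a set" where
  "forward_orbit g x = {(g ^^ n) x | n. n \<ge> 0}"

definition has_dense_orbit :: "('a::topological_space \<Rightarrow> 'a) \<Rightarrow> 'a \<Rightarrow> bool" where
  "has_dense_orbit g x \<longleftrightarrow> closure (forward_orbit g x) = UNIV"

definition transitive_map :: "('a::topological_space \<Rightarrow> 'a) \<Rightarrow> bool" where
  "transitive_map g \<longleftrightarrow> (\<exists>x. has_dense_orbit g x)"

definition robustly_transitive ::
  "('a::topological_space, 'e::euclidean_space) chart set \<Rightarrow> ('a \<Rightarrow> 'a) \<Rightarrow> bool" where
  "robustly_transitive A f \<longleftrightarrow>
     (\<exists>\<U>. C1_neighborhood A f \<U> \<and> (\<forall>g\<in>\<U>. transitive_map g))"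

definition persistent_critical_set ::
  "('a::topological_space, 'e::euclidean_space) chart set \<Rightarrow> ('a \<Rightarrow> 'a) \<Rightarrow> bool" where
  "persistent_critical_set A f \<longleftrightarrow>
     (\<exists>\<U>. C1_neighborhood A f \<U> \<and> (\<forall>g\<in>\<U>. critical_set A g \<noteq> {}))"


subsection \<open>Consistency of the definitions\<close>

lemma topspace_C1_topology:
  assumes "A \<noteq> {}"
  shows "topspace (C1_topology A) = C1_maps A"
proof -
  from assms obtain c where c: "c \<in> A" by blast
  have "f \<in> C1_subbasic A f c c {} 1" if "f \<in> C1_maps A" for f
    using that by (simp add: C1_subbasic_def)
  moreover have "compact ({} :: 'a set)" by simp
  ultimately have "C1_maps A \<subseteq> \<Union> {C1_subbasic A f c d K \<epsilon> | f c d K \<epsilon>. f \<in> C1_maps A \<and> c \<in> A \<and> d \<in> A \<and>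
        compact K \<and> K \<subseteq> chart_dom c \<and> f ` K \<subseteq> chart_dom d \<and> 0 < \<epsilon>}"
    using c by (smt (verit, del_insts) Union_iff empty_subsetI image_empty mem_Collect_eq subsetI zero_less_one)
  moreover have "\<Union> {C1_subbasic A f c d K \<epsilon> | f c d K \<epsilon>. f \<in> C1_maps A \<and> c \<in> A \<and> d \<in> A \<and>
        compact K \<and> K \<subseteq> chart_dom c \<and> f ` K \<subseteq> chart_dom d \<and> 0 < \<epsilon>} \<subseteq> C1_maps A"
    by (auto simp: C1_subbasic_def)
  ultimately show ?thesis
    unfolding C1_topology_def topology_generated_by_topspace by (rule antisym[rotated])
qed

context smooth_manifold
begin

lemma charts_at_nonempty: "charts_at A p \<noteq> {}"
proof -
  have "p \<in> (\<Union>c\<in>A. chart_dom c)" using cover by simp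
  then show ?thesis unfolding charts_at_def by blast
qed

lemma chart_inv_map:
  assumes "c \<in> charts_at A p"
  shows "chart_inv c (chart_map c p) = p"
  using assms charts by (auto simp: charts_at_def is_chart_def homeomorphism_def)

lemma open_chart_image:
  assumes "c \<in> A" "open V"
  shows "open (chart_map c ` (chart_dom c \<inter> V))"
proof -
  have *: "open (chart_map c ` chart_dom c)"
    "homeomorphism (chart_dom c) (chart_map c ` chart_dom c) (chart_map c) (chart_inv c)"
    using charts[OF assms(1)] by (auto simp: is_chart_def)
  have "openin (top_of_set (chart_map c ` chart_dom c)) (chart_map c ` (chart_dom c \<inter> V))"
    using homeomorphism_imp_open_map[OF *(2)] assms(2) by (simp add: openin_open_Int)
  with *(1) show ?thesis using openin_open_trans by blast
qed

lemma transition_differentiable: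
  assumes "c \<in> charts_at A p" "d \<in> charts_at A p"
  shows "(chart_map d \<circ> chart_inv c) differentiable (at (chart_map c p))"
proof -
  have "Ck_on (Suc 0) (chart_map c ` (chart_dom c \<inter> chart_dom d)) (chart_map d \<circ> chart_inv c)"
    using compatible assms unfolding smooth_on_def charts_at_def by blast
  with assms show ?thesis by (auto simp: charts_at_def)
qed

lemma local_rep_differentiable:
  assumes "g \<in> C1_maps A" "c \<in> charts_at A p" "d \<in> charts_at A (g p)"
  shows "local_rep c d g differentiable (at (chart_map c p))"
  using assms by (fastforce simp: C1_maps_def charts_at_def)

lemma local_rep_derivative_change:
  assumes g: "g \<in> C1_maps A" and c: "c \<in> charts_at A p" "c' \<in> charts_at A p"
    and d: "d \<in> charts_at A (g p)" "d' \<in> charts_at A (g p)"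
  shows "frechet_derivative (local_rep c' d' g) (at (chart_map c' p)) \<circ>
           frechet_derivative (chart_map c' \<circ> chart_inv c) (at (chart_map c p)) =
         frechet_derivative (chart_map d' \<circ> chart_inv d) (at (chart_map d (g p))) \<circ>
           frechet_derivative (local_rep c d g) (at (chart_map c p))"
proof -
  define x where "x = chart_map c p"
  have inv: "chart_inv c x = p" using chart_inv_map[OF c(1)] by (simp add: x_def)
  have cA: "c \<in> A" "c' \<in> A" "d \<in> A" "d' \<in> A" using c d by (auto simp: charts_at_def)
  have cont: "continuous_on UNIV g" using g by (simp add: C1_maps_def)
  have opn: "open (chart_dom b)" if "b \<in> A" for b
    using charts[OF that] by (simp add: is_chart_def)
  define V where "V = chart_dom c' \<inter> g -` chart_dom d"
  have "open V" unfolding V_def using cont opn cA by (intro open_Int open_vimage) auto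
  define N where "N = chart_map c ` (chart_dom c \<inter> V)"
  have N: "open N" "x \<in> N"
    using open_chart_image[OF cA(1) \<open>open V\<close>] c d by (auto simp: N_def V_def x_def charts_at_def)
  have eq: "(local_rep c' d' g \<circ> (chart_map c' \<circ> chart_inv c)) y =
      ((chart_map d' \<circ> chart_inv d) \<circ> local_rep c d g) y" if y: "y \<in> N" for y
  proof -
    obtain q where q: "q \<in> chart_dom c" "q \<in> chart_dom c'" "g q \<in> chart_dom d" "y = chart_map c q"
      using y unfolding N_def V_def by blast
    then have "chart_inv c y = q" "chart_inv c' (chart_map c' q) = q"
      "chart_inv d (chart_map d (g q)) = g q"
      using cA chart_inv_map by (auto simp: charts_at_def)
    then show ?thesis by (simp add: local_rep_def)
  qed
  have D1: "((local_rep c' d' g \<circ> (chart_map c' \<circ> chart_inv c)) has_derivative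
      (frechet_derivative (local_rep c' d' g) (at (chart_map c' p)) \<circ>
       frechet_derivative (chart_map c' \<circ> chart_inv c) (at x))) (at x)"
    using transition_differentiable[OF c] local_rep_differentiable[OF g c(2) d(2)] inv
    by (intro diff_chain_at) (auto simp: frechet_derivative_works x_def)
  have D2: "(((chart_map d' \<circ> chart_inv d) \<circ> local_rep c d g) has_derivative
      (frechet_derivative (chart_map d' \<circ> chart_inv d) (at (chart_map d (g p))) \<circ>
       frechet_derivative (local_rep c d g) (at x))) (at x)"
    using transition_differentiable[OF d] local_rep_differentiable[OF g c(1) d(1)] inv
    by (intro diff_chain_at) (auto simp: frechet_derivative_works x_def local_rep_def)
  have "((local_rep c' d' g \<circ> (chart_map c' \<circ> chart_inv c)) has_derivative
      (frechet_derivative (chart_map d' \<circ> chart_inv d) (at (chart_map d (g p))) \<circ>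
       frechet_derivative (local_rep c d g) (at x))) (at x)"
    using has_derivative_transform_within_open[OF D2 N] eq by metis
  with D1 show ?thesis unfolding x_def by (rule has_derivative_unique)
qed

lemma transition_self:
  assumes "c \<in> charts_at A p"
  shows "frechet_derivative (chart_map c \<circ> chart_inv c) (at (chart_map c p)) = id"
proof -
  have cA: "c \<in> A" using assms by (simp add: charts_at_def)
  have N: "open (chart_map c ` (chart_dom c \<inter> UNIV))" "chart_map c p \<in> chart_map c ` (chart_dom c \<inter> UNIV)"
    using open_chart_image[OF cA, of UNIV] assms by (auto simp: charts_at_def)
  have "((chart_map c \<circ> chart_inv c) has_derivative id) (at (chart_map c p))"
  proof (rule has_derivative_transform_within_open[OF has_derivative_id N])
    fix y assume "y \<in> chart_map c ` (chart_dom c \<inter> UNIV)"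
    then obtain q where "q \<in> chart_dom c" "y = chart_map c q" by blast
    then show "id y = (chart_map c \<circ> chart_inv c) y"
      using chart_inv_map[of c q] cA by (simp add: charts_at_def)
  qed
  then show ?thesis by (rule frechet_derivative_at[symmetric])
qed

lemma differential_eq:
  assumes g: "g \<in> C1_maps A" and c: "c \<in> charts_at A p" and d: "d \<in> charts_at A (g p)"
    and \<xi>: "\<xi> \<in> tangent_space A p"
  shows "differential A g p \<xi> d = frechet_derivative (local_rep c d g) (at (chart_map c p)) (\<xi> c)"
proof -
  define b where "b = (SOME b. b \<in> charts_at A p)"
  have b: "b \<in> charts_at A p" unfolding b_def using charts_at_nonempty by (simp add: some_in_eq)
  have "\<xi> b = frechet_derivative (chart_map b \<circ> chart_inv c) (at (chart_map c p)) (\<xi> c)"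
    using \<xi> b c unfolding tangent_space_def by blast
  then show ?thesis
    using fun_cong[OF local_rep_derivative_change[OF g c b d d], of "\<xi> c"] d transition_self[OF d]
    by (simp add: differential_def b_def[symmetric] Let_def)
qed

lemma differential_in_tangent_space:
  assumes g: "g \<in> C1_maps A" and \<xi>: "\<xi> \<in> tangent_space A p"
  shows "differential A g p \<xi> \<in> tangent_space A (g p)"
proof -
  obtain c where c: "c \<in> charts_at A p" using charts_at_nonempty by blast
  have "differential A g p \<xi> d' =
      frechet_derivative (chart_map d' \<circ> chart_inv d) (at (chart_map d (g p))) (differential A g p \<xi> d)"
    if d: "d \<in> charts_at A (g p)" "d' \<in> charts_at A (g p)" for d d'
    using fun_cong[OF local_rep_derivative_change[OF g c c d], of "\<xi> c"] transition_self[OF c]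
      differential_eq[OF g c d(1) \<xi>] differential_eq[OF g c d(2) \<xi>] by simp
  moreover have "differential A g p \<xi> d = 0" if "d \<notin> charts_at A (g p)" for d
    using that by (simp add: differential_def)
  ultimately show ?thesis unfolding tangent_space_def by blast
qed

end

end

theory Submission
  imports Defs "HOL-Analysis.Urysohn"
begin

text \<open>Both parts only use perturbations supported in one chart around a critical point.

  If the differential vanishes at \<open>p\<close>, then \<open>f\<close> is \<open>C\<^sup>1\<close>-close to maps that are constant near \<open>p\<close>;
  a dense orbit of such a map visits that neighbourhood twice and hence is eventually periodic,
  which is impossible because the manifold has no isolated points.

  For the dense critical orbit, consider the pairs of a \<open>C\<^sup>1\<close>-small perturbation of \<open>f\<close> and one of
  its critical points in the chart. They form a completely metrizable space, and the pairs whose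
  critical point visits a given open set are open in it. They are also dense: take a dense orbit of
  the perturbed map and a point of it very close to the critical point. A small change of the
  derivative makes that point critical, and its support can be taken so small that the orbit does
  not return to it before visiting the open set. Now apply Baire's theorem to a countable basis.\<close>

subsection \<open>Linear and \<open>C\<^sup>1\<close> maps between Euclidean spaces\<close>

text \<open>One perturbation cannot produce the dense critical orbit. A dense orbit returns to every
  neighbourhood of the point that is made critical, so a perturbation supported there controls only
  a finite piece of it; this is what forces the Baire argument. Its space consists of pairs because
  making a nearby orbit point critical moves the critical point together with the map. Criticality
  is a closed condition, since the noninvertible operators form a closed set; this makes the space
  of pairs completely metrizable. It is nonempty because persistence yields a critical point of f
  itself, which is paired with the zero perturbation.\<close>

lemma tendsto_apply_bcontfun:
  fixes u :: "'a::topological_space \<Rightarrow>\<^sub>C 'b::metric_space"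
  assumes u: "(U \<longlongrightarrow> u) F" and x: "(X \<longlongrightarrow> x) F"
  shows "((\<lambda>n. apply_bcontfun (U n) (X n)) \<longlongrightarrow> apply_bcontfun u x) F"
proof -
  have "((\<lambda>n. apply_bcontfun u (X n)) \<longlongrightarrow> apply_bcontfun u x) F"
    using continuous_on_tendsto_compose[OF continuous_on_apply_bcontfun[of UNIV] x] by simp
  then have "((\<lambda>n. dist (apply_bcontfun u (X n)) (apply_bcontfun u x)) \<longlongrightarrow> 0) F"
    by (simp add: tendsto_dist_iff[symmetric])
  moreover have "((\<lambda>n. dist (U n) u) \<longlongrightarrow> 0) F"
    using u by (simp add: tendsto_dist_iff[symmetric])
  ultimately have *: "((\<lambda>n. dist (U n) u + dist (apply_bcontfun u (X n)) (apply_bcontfun u x)) \<longlongrightarrow> 0) F"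
    using tendsto_add by fastforce
  \<comment> \<open>Uniform closeness replaces \<open>U n\<close> by \<open>u\<close> at the same
    point; continuity of \<open>u\<close> then moves the point.\<close>
  have "dist (apply_bcontfun (U n) (X n)) (apply_bcontfun u x)
      \<le> dist (U n) u + dist (apply_bcontfun u (X n)) (apply_bcontfun u x)" for n
    using dist_triangle[of "apply_bcontfun (U n) (X n)" "apply_bcontfun u x" "apply_bcontfun u (X n)"]
      dist_bounded[of "U n" "X n" u] by linarith
  then have "((\<lambda>n. dist (apply_bcontfun (U n) (X n)) (apply_bcontfun u x)) \<longlongrightarrow> 0) F"
    by (intro tendsto_sandwich[OF _ _ tendsto_const *]) auto
  then show ?thesis by (simp add: tendsto_dist_iff[symmetric])
qed

text \<open>\<open>Ck_on\<close> controls derivatives only in each fixed direction. Expanding the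
  argument in the finite basis upgrades this to moving arguments, as compositions of derivatives
  require.\<close>

lemma tendsto_linear_apply:
  fixes L :: "'b \<Rightarrow> 'e::euclidean_space \<Rightarrow> 'c::real_normed_vector"
  assumes lin: "\<forall>\<^sub>F n in F. linear (L n)" "linear M"
    and L: "\<And>v. ((\<lambda>n. L n v) \<longlongrightarrow> M v) F" and w: "(w \<longlongrightarrow> v) F"
  shows "((\<lambda>n. L n (w n)) \<longlongrightarrow> M v) F"
proof -
  have e: "T x = (\<Sum>b\<in>Basis. (x \<bullet> b) *\<^sub>R T b)" if "linear T" for T :: "'e \<Rightarrow> 'c" and x
    using linear_sum[OF that, of "\<lambda>b. (x \<bullet> b) *\<^sub>R b" Basis] linear_scale[OF that]
    by (simp add: euclidean_representation)
  have "((\<lambda>n. \<Sum>b\<in>Basis. (w n \<bullet> b) *\<^sub>R L n b) \<longlongrightarrow> (\<Sum>b\<in>Basis. (v \<bullet> b) *\<^sub>R M b)) F"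
    by (intro tendsto_intros L w)
  moreover have "\<forall>\<^sub>F n in F. (\<Sum>b\<in>Basis. (w n \<bullet> b) *\<^sub>R L n b) = L n (w n)"
    using lin(1) by eventually_elim (rule e[symmetric])
  ultimately have "((\<lambda>n. L n (w n)) \<longlongrightarrow> (\<Sum>b\<in>Basis. (v \<bullet> b) *\<^sub>R M b)) F"
    by (rule Lim_transform_eventually)
  then show ?thesis using e[OF lin(2), of v] by simp
qed

lemma onorm_le_sum_Basis:
  fixes L :: "'e::euclidean_space \<Rightarrow> 'c::real_normed_vector"
  assumes "linear L"
  shows "onorm L \<le> (\<Sum>b\<in>Basis. norm (L b))"
proof (rule onorm_bound)
  fix x :: 'e
  have "L x = (\<Sum>b\<in>Basis. (x \<bullet> b) *\<^sub>R L b)"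
    using linear_sum[OF assms, of "\<lambda>b. (x \<bullet> b) *\<^sub>R b" Basis] linear_scale[OF assms]
    by (simp add: euclidean_representation)
  also have "norm \<dots> \<le> (\<Sum>b\<in>Basis. norm x * norm (L b))"
    by (intro sum_norm_le) (simp add: mult_right_mono Basis_le_norm)
  finally show "norm (L x) \<le> (\<Sum>b\<in>Basis. norm (L b)) * norm x"
    by (simp add: sum_distrib_left mult.commute)
qed (simp add: sum_nonneg)

text \<open>The C1 subbasis measures derivatives in operator norm, while limits are available
  direction by direction; \<open>onorm_le_sum_Basis\<close> bridges the two.\<close>

lemma eventually_onorm_less:
  fixes L :: "'b \<Rightarrow> 'e::euclidean_space \<Rightarrow> 'c::real_normed_vector"
  assumes lin: "\<forall>\<^sub>F n in F. linear (L n)" "linear M"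
    and L: "\<And>v. ((\<lambda>n. L n v) \<longlongrightarrow> M v) F" and M: "onorm M < e"
  shows "\<forall>\<^sub>F n in F. onorm (L n) < e"
proof -
  have "((\<lambda>n. \<Sum>b\<in>Basis. norm (L n b - M b)) \<longlongrightarrow> (\<Sum>b\<in>Basis. norm (M b - M b))) F"
    by (intro tendsto_intros L)
  then have "\<forall>\<^sub>F n in F. (\<Sum>b\<in>Basis. norm (L n b - M b)) < e - onorm M"
    using M by (intro order_tendstoD) auto
  with lin(1) show ?thesis
  proof eventually_elim
    case (elim n)
    note lin = elim(1) lin(2)
    have "onorm (\<lambda>x. M x + (L n x - M x)) \<le> onorm M + onorm (\<lambda>x. L n x - M x)"
      using lin by (intro onorm_triangle) (auto simp: linear_conv_bounded_linear bounded_linear_sub)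
    moreover have "onorm (\<lambda>x. L n x - M x) \<le> (\<Sum>b\<in>Basis. norm (L n b - M b))"
      using lin by (intro onorm_le_sum_Basis linear_compose_sub)
    ultimately show ?case using elim by simp
  qed
qed

lemma Ck_on_1I:
  assumes "\<And>x. x \<in> S \<Longrightarrow> (f has_derivative f' x) (at x)" "\<And>v. continuous_on S (\<lambda>x. f' x v)"
  shows "Ck_on 1 S f"
proof -
  have "frechet_derivative f (at x) = f' x" if "x \<in> S" for x
    using frechet_derivative_at[OF assms(1)[OF that]] by simp
  then have "continuous_on S (\<lambda>x. frechet_derivative f (at x) v)" for v
    using assms(2)[of v] by (simp cong: continuous_on_cong)
  moreover have "\<forall>x\<in>S. f differentiable (at x)"
    using assms(1) differentiableI by blast
  ultimately show ?thesis by (simp only: One_nat_def Ck_on.simps) blast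
qed

lemma Ck_on_1D:
  assumes "Ck_on 1 S f"
  shows "x \<in> S \<Longrightarrow> (f has_derivative frechet_derivative f (at x)) (at x)"
    and "continuous_on S (\<lambda>x. frechet_derivative f (at x) v)"
  using assms unfolding One_nat_def Ck_on.simps frechet_derivative_works[symmetric] by blast+

lemma Ck_on_1_tendsto:
  assumes "Ck_on 1 S f" "(X \<longlongrightarrow> x) F" "\<forall>\<^sub>F n in F. X n \<in> S" "x \<in> S"
  shows "((\<lambda>n. frechet_derivative f (at (X n)) v) \<longlongrightarrow> frechet_derivative f (at x) v) F"
  using continuous_on_tendsto_compose[OF Ck_on_1D(2)[OF assms(1)] assms(2,4,3)] .

lemma Ck_on_1_compose:
  assumes F: "Ck_on 1 S F" and G: "Ck_on 1 T G" and im: "F ` S \<subseteq> T"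
  shows "Ck_on 1 S (G \<circ> F)"
proof (rule Ck_on_1I)
  have dG: "(G has_derivative frechet_derivative G (at (F x))) (at (F x))" if "x \<in> S" for x
    using Ck_on_1D(1)[OF G] im that by blast
  show "(G \<circ> F has_derivative frechet_derivative G (at (F x)) \<circ> frechet_derivative F (at x)) (at x)"
    if "x \<in> S" for x
    using Ck_on_1D(1)[OF F that] dG[OF that] by (rule diff_chain_at)
  fix v
  have cF: "continuous_on S F"
    by (intro continuous_at_imp_continuous_on ballI has_derivative_continuous[OF Ck_on_1D(1)[OF F]])
  have "((\<lambda>x. frechet_derivative G (at (F x)) (frechet_derivative F (at x) v)) \<longlongrightarrow>
      frechet_derivative G (at (F x)) (frechet_derivative F (at x) v)) (at x within S)" if x: "x \<in> S" for x
  \<comment> \<open>By the chain rule the derivative is a composition in which the operator and its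
    argument both vary with x.\<close>
  proof (rule tendsto_linear_apply[where L = "\<lambda>x. frechet_derivative G (at (F x))"
        and w = "\<lambda>x. frechet_derivative F (at x) v" and M = "frechet_derivative G (at (F x))"])
    show "\<forall>\<^sub>F y in at x within S. linear (frechet_derivative G (at (F y)))"
      unfolding eventually_at_filter using dG has_derivative_linear
      by (blast intro: always_eventually)
    show "linear (frechet_derivative G (at (F x)))"
      using dG[OF x] has_derivative_linear by blast
    have "continuous_on S (\<lambda>y. frechet_derivative G (at (F y)) w)" for w
      using continuous_on_compose2[OF Ck_on_1D(2)[OF G] cF im] .
    then show "((\<lambda>y. frechet_derivative G (at (F y)) w) \<longlongrightarrow> frechet_derivative G (at (F x)) w) (at x within S)" for w
      using x unfolding continuous_on_def by blast
    show "((\<lambda>y. frechet_derivative F (at y) v) \<longlongrightarrow> frechet_derivative F (at x) v) (at x within S)"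
      using Ck_on_1D(2)[OF F] x unfolding continuous_on_def by blast
  qed
  then show "continuous_on S (\<lambda>x. (frechet_derivative G (at (F x)) \<circ> frechet_derivative F (at x)) v)"
    by (simp add: continuous_on_def)
qed

lemma Ck_on_1_cong:
  assumes "Ck_on 1 S F" "open S" "\<And>x. x \<in> S \<Longrightarrow> F x = G x"
  shows "Ck_on 1 S G"
proof (rule Ck_on_1I)
  show "(G has_derivative frechet_derivative F (at x)) (at x)" if "x \<in> S" for x
    using has_derivative_transform_within_open[OF Ck_on_1D(1)[OF assms(1) that] assms(2) that] assms(3)
    by blast
qed (rule Ck_on_1D(2)[OF assms(1)])

lemma Ck_on_1_Un:
  assumes "Ck_on 1 S F" "Ck_on 1 T F" "open S" "open T"
  shows "Ck_on 1 (S \<union> T) F"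
proof (rule Ck_on_1I)
  show "(F has_derivative frechet_derivative F (at x)) (at x)" if "x \<in> S \<union> T" for x
    using that Ck_on_1D(1)[OF assms(1)] Ck_on_1D(1)[OF assms(2)] by blast
  show "continuous_on (S \<union> T) (\<lambda>x. frechet_derivative F (at x) v)" for v
    using assms(3,4) Ck_on_1D(2)[OF assms(1)] Ck_on_1D(2)[OF assms(2)] by (rule continuous_on_open_Un)
qed

lemma Ck_on_subset: "Ck_on k S f \<Longrightarrow> T \<subseteq> S \<Longrightarrow> Ck_on k T f"
proof (induction k arbitrary: f)
  case (Suc k)
  then show ?case unfolding Ck_on.simps by blast
qed (auto intro: continuous_on_subset)

text \<open>Kernel vectors normalised to length one lie in a compact sphere, so a subsequence tends
  to a unit vector that the limit operator kills.\<close>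

lemma closed_not_inj_blinfun: "closed {T :: 'e::euclidean_space \<Rightarrow>\<^sub>L 'e. \<not> inj (blinfun_apply T)}"
  unfolding closed_sequential_limits
proof (intro allI impI)
  fix X and T :: "'e \<Rightarrow>\<^sub>L 'e"
  assume "(\<forall>n. X n \<in> {T. \<not> inj (blinfun_apply T)}) \<and> X \<longlonglongrightarrow> T"
  then have X: "\<And>n. \<not> inj (blinfun_apply (X n))" and lim: "X \<longlonglongrightarrow> T" by auto
  have "\<exists>v. v \<in> sphere 0 1 \<and> blinfun_apply (X n) v = 0" for n
  proof -
    obtain v where v: "blinfun_apply (X n) v = 0" "v \<noteq> 0"
      using X[of n] linear_injective_0[of "blinfun_apply (X n)"]
        bounded_linear.linear[OF blinfun.bounded_linear_right] by blast
    then show ?thesis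
      by (intro exI[of _ "v /\<^sub>R norm v"]) (simp add: blinfun.scaleR_right)
  qed
  then obtain v where v: "\<And>n. v n \<in> sphere 0 1" "\<And>n. blinfun_apply (X n) (v n) = 0" by metis
  obtain w and k :: "nat \<Rightarrow> nat" where w: "w \<in> sphere 0 1" "strict_mono k" "(v \<circ> k) \<longlonglongrightarrow> w"
    using compact_sphere[of 0 1] v(1) unfolding compact_def by metis
  have "(\<lambda>n. blinfun_apply ((X \<circ> k) n) ((v \<circ> k) n)) \<longlonglongrightarrow> blinfun_apply T w"
    by (intro tendsto_intros LIMSEQ_subseq_LIMSEQ lim w)
  then have "(\<lambda>_. 0) \<longlonglongrightarrow> blinfun_apply T w" unfolding o_apply v(2) .
  then have "blinfun_apply T w = 0" by (rule LIMSEQ_unique[OF _ tendsto_const])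
  then have "blinfun_apply T w = blinfun_apply T 0" by (simp add: blinfun.zero_right)
  moreover have "w \<noteq> 0" using w(1) by (auto simp: dist_norm)
  ultimately have "\<not> inj (blinfun_apply T)" using injD by fastforce
  then show "T \<in> {T. \<not> inj (blinfun_apply T)}" by simp
qed

subsection \<open>Compactly supported \<open>C\<^sup>1\<close> perturbations\<close>

text \<open>A perturbation is paired with its derivative, so that the norm of the pair is equivalent to
  the \<open>C\<^sup>1\<close> norm and completeness is inherited from the bounded continuous functions.\<close>

definition C1_perturbations ::
  "'e::euclidean_space \<Rightarrow> real \<Rightarrow> (('e \<Rightarrow>\<^sub>C 'e) \<times> ('e \<Rightarrow>\<^sub>C 'e \<Rightarrow>\<^sub>L 'e)) set" where
  "C1_perturbations a r = {s.
     (\<forall>x. (apply_bcontfun (fst s) has_derivative blinfun_apply (apply_bcontfun (snd s) x)) (at x)) \<and>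
     (\<forall>x. x \<notin> ball a r \<longrightarrow> apply_bcontfun (fst s) x = 0)}"

lemma C1_perturbationsD:
  assumes "s \<in> C1_perturbations a r"
  shows "(apply_bcontfun (fst s) has_derivative blinfun_apply (apply_bcontfun (snd s) x)) (at x)"
    and "x \<notin> ball a r \<Longrightarrow> apply_bcontfun (fst s) x = 0"
  using assms by (auto simp: C1_perturbations_def)

lemma C1_perturbations_zero: "0 \<in> C1_perturbations a r"
  by (simp add: C1_perturbations_def zero_blinfun.rep_eq)

lemma C1_perturbations_add:
  assumes "s \<in> C1_perturbations a r" "t \<in> C1_perturbations b q" "ball b q \<subseteq> ball a r"
  shows "s + t \<in> C1_perturbations a r"
  using assms by (auto simp: C1_perturbations_def plus_blinfun.rep_eq subset_iff intro!: has_derivative_add)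

text \<open>The second components converge uniformly, so their limit is the derivative of the limit;
  vanishing outside the ball passes to the limit pointwise.\<close>

lemma closed_C1_perturbations: "closed (C1_perturbations (a::'e::euclidean_space) r)"
  unfolding closed_sequential_limits
proof (intro allI impI)
  fix X and s :: "('e \<Rightarrow>\<^sub>C 'e) \<times> ('e \<Rightarrow>\<^sub>C 'e \<Rightarrow>\<^sub>L 'e)"
  assume "(\<forall>n. X n \<in> C1_perturbations a r) \<and> X \<longlonglongrightarrow> s"
  then have X: "\<And>n. X n \<in> C1_perturbations a r" and lim: "X \<longlonglongrightarrow> s" by auto
  note lim1 = tendsto_fst[OF lim] and lim2 = tendsto_snd[OF lim]
  have pt: "(\<lambda>n. apply_bcontfun (fst (X n)) x) \<longlonglongrightarrow> apply_bcontfun (fst s) x" for x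
    by (rule tendsto_apply_bcontfun[OF lim1 tendsto_const])
  have "\<exists>g. \<forall>x\<in>UNIV. (\<lambda>n. apply_bcontfun (fst (X n)) x) \<longlonglongrightarrow> g x \<and>
      (g has_derivative blinfun_apply (apply_bcontfun (snd s) x)) (at x within UNIV)"
  proof (rule has_derivative_sequence)
    show "(\<lambda>n. apply_bcontfun (fst (X n)) a) \<longlonglongrightarrow> apply_bcontfun (fst s) a" by (rule pt)
    show "(apply_bcontfun (fst (X n)) has_derivative blinfun_apply (apply_bcontfun (snd (X n)) x))
        (at x within UNIV)" for n x
      using C1_perturbationsD(1)[OF X] by simp
    fix e :: real assume "e > 0"
    then have "\<forall>\<^sub>F n in sequentially. dist (snd (X n)) (snd s) < e"
      using lim2 by (simp add: tendsto_iff)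
    then show "\<forall>\<^sub>F n in sequentially. \<forall>x\<in>UNIV. \<forall>h.
        norm (blinfun_apply (apply_bcontfun (snd (X n)) x) h - blinfun_apply (apply_bcontfun (snd s) x) h) \<le> e * norm h"
    proof eventually_elim
      case (elim n)
      have "norm (blinfun_apply (apply_bcontfun (snd (X n)) x - apply_bcontfun (snd s) x) h) \<le> e * norm h" for x h
              proof (rule order_trans[OF norm_blinfun mult_right_mono])
        show "norm (apply_bcontfun (snd (X n)) x - apply_bcontfun (snd s) x) \<le> e"
          using dist_bounded[of "snd (X n)" x "snd s"] elim by (simp add: dist_norm)
      qed simp
      then show ?case by (simp add: minus_blinfun.rep_eq)
    qed
  qed auto
  then obtain g where g: "\<And>x. (\<lambda>n. apply_bcontfun (fst (X n)) x) \<longlonglongrightarrow> g x"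
    "\<And>x. (g has_derivative blinfun_apply (apply_bcontfun (snd s) x)) (at x)" by auto
  have "g = apply_bcontfun (fst s)" using g(1) pt LIMSEQ_unique by blast
  moreover have "apply_bcontfun (fst s) x = 0" if "x \<notin> ball a r" for x
    using pt[of x] C1_perturbationsD(2)[OF X that] by (simp add: LIMSEQ_const_iff)
  ultimately show "s \<in> C1_perturbations a r" using g(2) by (simp add: C1_perturbations_def)
qed

section \<open>A C1 cutoff with explicit constants\<close>

lemma has_real_derivative_pos_part_square:
  "((\<lambda>t::real. (max 0 t)\<^sup>2) has_real_derivative 2 * max 0 t) (at t)"
proof -
  consider "t < 0" | "t = 0" | "t > 0" by linarith
  then show ?thesis
  proof cases
    case 1
    have "((\<lambda>t::real. 0) has_real_derivative 0) (at t)" by simp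
    from has_field_derivative_transform_within_open[OF this, of "{..<0}"] show ?thesis
      using 1 by simp
  next
    case 2
    have "(\<lambda>h::real. (max 0 h)\<^sup>2 / h) \<midarrow>0\<rightarrow> 0"
    proof (rule Lim_null_comparison)
      show "\<forall>\<^sub>F h::real in at 0. norm ((max 0 h)\<^sup>2 / h) \<le> \<bar>h\<bar>"
        by (auto simp: max_def power2_eq_square intro!: always_eventually)
      show "(\<lambda>h::real. \<bar>h\<bar>) \<midarrow>0\<rightarrow> 0" by (intro tendsto_eq_intros) auto
    qed
    then show ?thesis using 2 by (simp add: DERIV_def)
  next
    case 3
    have "((\<lambda>t::real. t\<^sup>2) has_real_derivative 2 * t) (at t)"
      by (auto intro!: derivative_eq_intros)
    from has_field_derivative_transform_within_open[OF this, of "{0<..}"] show ?thesis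
      using 3 by simp
  qed
qed

text \<open>A C1 transition from 1 on the nonpositive reals to 0 from 1 onwards. Squaring removes
  the corner of each positive part.\<close>

definition bump :: "real \<Rightarrow> real" where
  "bump w = (max 0 (1 - (max 0 w)\<^sup>2))\<^sup>2"

definition bump_deriv :: "real \<Rightarrow> real" where
  "bump_deriv w = - 4 * max 0 (1 - (max 0 w)\<^sup>2) * max 0 w"

lemma has_real_derivative_bump: "(bump has_real_derivative bump_deriv w) (at w)"
proof -
  have "((\<lambda>w. 1 - (max 0 w)\<^sup>2) has_real_derivative - (2 * max 0 w)) (at w)"
    using DERIV_diff[OF DERIV_const has_real_derivative_pos_part_square, of 1] by simp
  from DERIV_chain2[OF has_real_derivative_pos_part_square this] show ?thesis
    by (simp add: bump_def[abs_def] bump_deriv_def mult.assoc)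
qed

lemma bump_values:
  "w \<le> 0 \<Longrightarrow> bump w = 1" "w \<ge> 1 \<Longrightarrow> bump w = 0"
  "w \<le> 0 \<Longrightarrow> bump_deriv w = 0" "w \<ge> 1 \<Longrightarrow> bump_deriv w = 0"
  by (auto simp: bump_def bump_deriv_def one_le_power)

lemma bump_bounds: "0 \<le> bump w" "bump w \<le> 1" "\<bar>bump_deriv w\<bar> \<le> 4"
proof -
  have *: "0 \<le> max 0 (1 - (max 0 w)\<^sup>2)" "max 0 (1 - (max 0 w)\<^sup>2) \<le> 1" by auto
  then show "0 \<le> bump w" "bump w \<le> 1" unfolding bump_def by (simp_all add: power_le_one)
  show "\<bar>bump_deriv w\<bar> \<le> 4"
  proof (cases "w \<ge> 1")
    case False
    then have "max 0 (1 - (max 0 w)\<^sup>2) * max 0 w \<le> 1 * 1" using * by (intro mult_mono) auto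
    then show ?thesis using * by (simp add: bump_deriv_def abs_mult)
  qed (simp add: bump_values)
qed

lemma continuous_bump: "continuous_on S bump" "continuous_on S bump_deriv"
  unfolding bump_def[abs_def] bump_deriv_def[abs_def] by (intro continuous_intros)+

text \<open>The bound does not depend on \<open>r\<close>: the derivative of the cutoff is of order \<open>1 / r\<close>, but \<open>q\<close>
  is of order \<open>\<epsilon> * r\<close> on the ball.\<close>

lemma cutoff_extension:
  fixes a :: "'e::euclidean_space" and q :: "'e \<Rightarrow> 'e" and q' :: "'e \<Rightarrow> 'e \<Rightarrow>\<^sub>L 'e"
  assumes r: "0 < r" "r \<le> 1"
    and q: "\<And>x. x \<in> cball a r \<Longrightarrow> (q has_derivative blinfun_apply (q' x)) (at x)"
    and cont: "continuous_on (cball a r) q'" and q0: "q a = 0"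
    and eps: "\<And>x. x \<in> cball a r \<Longrightarrow> norm (q' x) \<le> \<epsilon>"
  obtains s where "s \<in> C1_perturbations a r" "norm s \<le> 13 * \<epsilon>"
    "\<And>x. x \<in> cball a (r / 2) \<Longrightarrow> apply_bcontfun (fst s) x = q x"
    "apply_bcontfun (snd s) a = q' a"
proof -
  \<comment> \<open>With this constant \<open>w\<close> is 0 at distance r/2 from the centre and 1
    at distance r. The squared distance keeps \<open>w\<close> differentiable at the centre.\<close>
  define \<kappa> where "\<kappa> = 8 / (3 * r\<^sup>2)"
  define w where "w x = \<kappa> / 2 * ((x - a) \<bullet> (x - a)) - 1 / 3" for x
  have \<kappa>: "0 < \<kappa>" using r by (simp add: \<kappa>_def)
  have w_sq: "w x = (4 * (dist a x / r)\<^sup>2 - 1) / 3" for x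
    unfolding w_def \<kappa>_def by (simp add: dot_square_norm dist_norm norm_minus_commute power_divide field_simps)
  have w_out: "w x \<ge> 1" if "x \<notin> ball a r" for x
    using that r unfolding w_sq by (simp add: one_le_power)
  have w_in: "w x \<le> 0" if "x \<in> cball a (r / 2)" for x
  proof -
    have "(dist a x / r)\<^sup>2 \<le> (1 / 2)\<^sup>2"
      using that r by (intro power_mono) (auto simp: field_simps)
    also have "(1 / 2)\<^sup>2 = (1 / 4 :: real)" by (simp add: power2_eq_square)
    finally have *: "(dist a x / r)\<^sup>2 \<le> 1 / 4" .
    have "(4 * t - 1) / 3 \<le> 0" if "t \<le> 1 / 4" for t :: real using that by simp
    from this[OF *] show ?thesis unfolding w_sq .
  qed
  have dw: "(w has_derivative (\<lambda>v. \<kappa> * ((x - a) \<bullet> v))) (at x)" for x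
    unfolding w_def[abs_def] by (auto intro!: derivative_eq_intros simp: inner_commute)
  have db: "((\<lambda>x. bump (w x)) has_derivative (\<lambda>v. \<kappa> * ((x - a) \<bullet> v) * bump_deriv (w x))) (at x)" for x
    using has_derivative_compose[OF dw has_real_derivative_bump[THEN has_field_derivative_imp_has_derivative]]
    by (simp add: mult.commute)
  have cw: "continuous_on S w" for S
    unfolding w_def[abs_def] using r by (intro continuous_intros) auto
  have cq: "continuous_on (cball a r) q"
    by (intro continuous_at_imp_continuous_on ballI has_derivative_continuous[OF q])
  have \<epsilon>: "0 \<le> \<epsilon>" using order_trans[OF norm_ge_zero eps[of a]] r by simp
  have q_bound: "norm (q x) \<le> \<epsilon> * r" if x: "x \<in> cball a r" for x
  proof -
    have "norm (q x - q a) \<le> \<epsilon> * norm (x - a)"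
    proof (rule differentiable_bound[of "cball a r" q "\<lambda>x. blinfun_apply (q' x)"])
      show "(q has_derivative blinfun_apply (q' y)) (at y within cball a r)" if "y \<in> cball a r" for y
        using q[OF that] by (rule has_derivative_at_withinI)
      show "onorm (blinfun_apply (q' y)) \<le> \<epsilon>" if "y \<in> cball a r" for y
        using eps[OF that] by (simp add: norm_blinfun.rep_eq)
    qed (use x r in auto)
    also have "\<dots> \<le> \<epsilon> * r"
      using x \<epsilon> by (intro mult_left_mono) (auto simp: dist_norm norm_minus_commute)
    finally show ?thesis by (simp add: q0)
  qed
  define u where "u x = bump (w x) *\<^sub>R q x" for x
  \<comment> \<open>Product rule: the second summand is the derivative of the cutoff, v to
    \<open>bump_deriv (w x) * \<kappa> * ((x - a) \<bullet> v)\<close>, times the vector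
    \<open>q x\<close>.\<close>
  define D where "D x = bump (w x) *\<^sub>R q' x +
      (bump_deriv (w x) * \<kappa>) *\<^sub>R (blinfun_scaleR_left (q x) o\<^sub>L blinfun_inner_right (x - a))" for x
  have out: "u x = 0" "D x = 0" if "x \<notin> ball a r" for x
    using w_out[OF that] by (simp_all add: u_def D_def bump_values)
  have du: "(u has_derivative blinfun_apply (D x)) (at x)" for x
  proof (cases "x \<in> cball a r")
    case True
    show ?thesis
      unfolding u_def[abs_def] D_def
      by (rule has_derivative_eq_rhs[OF has_derivative_scaleR[OF db q[OF True]]])
        (simp add: fun_eq_iff blinfun.add_left blinfun.scaleR_left algebra_simps)
  next
    case False
    have "(u has_derivative (\<lambda>_. 0)) (at x)"
      by (rule has_derivative_transform_within_open[of "\<lambda>_. 0" _ _ _ "- cball a r"])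
        (use False out in auto)
    then show ?thesis using out(2)[of x] False by (simp add: zero_blinfun.rep_eq)
  qed
  \<comment> \<open>Continuity of \<open>q'\<close> is available only on the closed ball, but
    \<open>D\<close> vanishes off the open ball; these two closed sets cover the space, so
    \<open>D\<close> is continuous.\<close>
  have "continuous_on (cball a r) (\<lambda>x. D x j)" for j
    unfolding D_def blinfun.add_left blinfun.scaleR_left
    by (auto intro!: continuous_intros continuous_on_compose2[OF continuous_bump(1)[of UNIV]]
        continuous_on_compose2[OF continuous_bump(2)[of UNIV]] cw cq cont)
  then have "continuous_on (cball a r) D"
    by (intro continuous_on_blinfun_componentwise)
  moreover have "continuous_on (- ball a r) D"
    by (rule continuous_on_eq[OF continuous_on_const[of _ 0]]) (use out(2) in auto)
  moreover have "closed (- ball a r)" using open_ball by (rule closed_Compl)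
  ultimately have "continuous_on (cball a r \<union> - ball a r) D"
    using closed_cball continuous_on_closed_Un by blast
  moreover have "cball a r \<union> - ball a r = UNIV" by auto
  ultimately have cD: "continuous_on UNIV D" by metis
  have cu: "continuous_on UNIV u"
    by (intro continuous_at_imp_continuous_on ballI has_derivative_continuous[OF du])
  have ub: "norm (u x) \<le> \<epsilon>" for x
  proof (cases "x \<in> ball a r")
    case True
    then have "norm (q x) \<le> \<epsilon> * r" by (intro q_bound) auto
    also have "\<dots> \<le> \<epsilon> * 1" using r \<epsilon> by (intro mult_left_mono)
    finally have "bump (w x) * norm (q x) \<le> 1 * \<epsilon>" using bump_bounds[of "w x"] by (intro mult_mono) auto
    then show ?thesis using bump_bounds[of "w x"] by (simp add: u_def)
  qed (simp add: out \<epsilon>)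
  \<comment> \<open>The summands contribute at most \<epsilon> and 4 * \<kappa> * r * (\<epsilon> *
    r) = 32/3 * \<epsilon>, together at most 12 * \<epsilon>. The bound \<epsilon> for
    \<open>u\<close> raises this to 13 * \<epsilon> for the pair.\<close>
  have Db: "norm (D x) \<le> 12 * \<epsilon>" for x
  proof (cases "x \<in> ball a r")
    case True
    then have x: "x \<in> cball a r" by auto
    have "norm (blinfun_scaleR_left (q x) o\<^sub>L blinfun_inner_right (x - a)) \<le> r * (\<epsilon> * r)"
    proof (rule norm_blinfun_bound)
      fix v
      have "\<bar>(x - a) \<bullet> v\<bar> * norm (q x) \<le> (norm (x - a) * norm v) * (\<epsilon> * r)"
        using q_bound[OF x] by (intro mult_mono Cauchy_Schwarz_ineq2) auto
      also have "\<dots> \<le> (r * norm v) * (\<epsilon> * r)"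
        using x r \<epsilon> by (intro mult_right_mono) (auto simp: dist_norm norm_minus_commute)
      finally show "norm (blinfun_apply (blinfun_scaleR_left (q x) o\<^sub>L blinfun_inner_right (x - a)) v)
          \<le> r * (\<epsilon> * r) * norm v" by (simp add: mult_ac)
    qed (use r \<epsilon> in auto)
    then have "\<bar>bump_deriv (w x) * \<kappa>\<bar> * norm (blinfun_scaleR_left (q x) o\<^sub>L blinfun_inner_right (x - a))
        \<le> (4 * \<kappa>) * (r * (\<epsilon> * r))"
      using bump_bounds(3)[of "w x"] \<kappa> by (intro mult_mono) (simp_all add: abs_mult)
    also have "\<dots> = 32 / 3 * \<epsilon>" using r by (simp add: \<kappa>_def field_simps power2_eq_square)
    finally have 1: "norm ((bump_deriv (w x) * \<kappa>) *\<^sub>R (blinfun_scaleR_left (q x) o\<^sub>L blinfun_inner_right (x - a)))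
        \<le> 32 / 3 * \<epsilon>" by simp
    have "bump (w x) * norm (q' x) \<le> 1 * \<epsilon>"
      using bump_bounds[of "w x"] eps[OF x] by (intro mult_mono) auto
    then have 2: "norm (bump (w x) *\<^sub>R q' x) \<le> \<epsilon>" using bump_bounds[of "w x"] by simp
    show ?thesis unfolding D_def using norm_triangle_mono[OF 2 1] \<epsilon> by simp
  qed (simp add: out \<epsilon>)
  have u: "apply_bcontfun (Bcontfun u) = u" and D: "apply_bcontfun (Bcontfun D) = D"
    using bcontfun_normI[OF cu ub] bcontfun_normI[OF cD Db] by (auto intro: Bcontfun_inverse)
  show ?thesis
  proof (rule that[of "(Bcontfun u, Bcontfun D)"])
    show "(Bcontfun u, Bcontfun D) \<in> C1_perturbations a r"
      using du out by (simp add: C1_perturbations_def u D)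
    have "norm (Bcontfun u) \<le> \<epsilon>" "norm (Bcontfun D) \<le> 12 * \<epsilon>"
      using ub Db by (auto intro!: norm_bound simp: u D)
    then show "norm (Bcontfun u, Bcontfun D) \<le> 13 * \<epsilon>"
      using norm_Pair_le[of "Bcontfun u" "Bcontfun D"] by linarith
    show "apply_bcontfun (fst (Bcontfun u, Bcontfun D)) x = q x" if "x \<in> cball a (r / 2)" for x
      using w_in[OF that] by (simp add: u u_def bump_values)
    show "apply_bcontfun (snd (Bcontfun u, Bcontfun D)) a = q' a"
      using w_in[of a] r by (simp add: D D_def bump_values)
  qed
qed

subsection \<open>Critical points and dense orbits on manifolds\<close>

context smooth_manifold
begin

lemma chart_facts:
  assumes "c \<in> A"
  shows "open (chart_dom c)" "open (chart_map c ` chart_dom c)"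
    "continuous_on (chart_dom c) (chart_map c)"
    "continuous_on (chart_map c ` chart_dom c) (chart_inv c)"
    "p \<in> chart_dom c \<Longrightarrow> chart_inv c (chart_map c p) = p"
  using charts[OF assms] by (auto simp: is_chart_def homeomorphism_def)

lemma transition_C1:
  assumes "b \<in> A" "b' \<in> A"
  shows "Ck_on 1 (chart_map b ` (chart_dom b \<inter> chart_dom b')) (chart_map b' \<circ> chart_inv b)"
  using compatible[OF assms] unfolding smooth_on_def by blast

text \<open>A chart would carry a finite nonempty open set to one in Euclidean space, where none
  exists.\<close>

lemma infinite_open:
  fixes U :: "'a set"
  assumes "open U" "U \<noteq> {}"
  shows "infinite U"
proof
  assume fin: "finite U"
  from assms obtain p where p: "p \<in> U" by blast
  obtain c where c: "c \<in> A" "p \<in> chart_dom c" using cover by blast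
  have "open (chart_map c ` (chart_dom c \<inter> U))" using open_chart_image c assms by blast
  moreover have "finite (chart_map c ` (chart_dom c \<inter> U))" using fin by simp
  ultimately show False using finite_imp_not_open c p by blast
qed

text \<open>Applied to the identity, \<open>local_rep_derivative_change\<close> becomes the cocycle
  rule for the derivatives of coordinate changes.\<close>

lemma id_in_C1_maps: "(\<lambda>x. x) \<in> C1_maps A"
proof -
  have *: "Ck_on 1 (chart_map c ` (chart_dom c \<inter> (\<lambda>x. x) -` chart_dom d)) (local_rep c d (\<lambda>x. x))"
    if "c \<in> A" "d \<in> A" for c d
  proof -
    have "local_rep c d (\<lambda>x. x) = chart_map d \<circ> chart_inv c"
      "chart_dom c \<inter> (\<lambda>x. x) -` chart_dom d = chart_dom c \<inter> chart_dom d"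
      by (auto simp: local_rep_def)
    then show ?thesis using compatible[OF that] unfolding smooth_on_def by metis
  qed
  show ?thesis unfolding C1_maps_def mem_Collect_eq
    by (intro conjI ballI continuous_on_id) (rule *)
qed

text \<open>The coordinate in one chart determines a tangent vector. Conversely, any vector spreads
  to all charts by the transition derivatives, consistently by the cocycle rule.\<close>

lemma bij_betw_tangent_coordinates:
  assumes c: "c \<in> charts_at A p"
  shows "bij_betw (\<lambda>\<xi>. \<xi> c) (tangent_space A p) UNIV"
proof (rule bij_betw_byWitness)
  let ?T = "\<lambda>c d. frechet_derivative (chart_map d \<circ> chart_inv c) (at (chart_map c p))"
  let ?\<xi> = "\<lambda>v d. if d \<in> charts_at A p then ?T c d v else 0"
  show "\<forall>\<xi>\<in>tangent_space A p. ?\<xi> (\<xi> c) = \<xi>"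
  proof (intro ballI ext)
    fix \<xi> d assume "\<xi> \<in> tangent_space A p"
    then have "d \<in> charts_at A p \<Longrightarrow> \<xi> d = ?T c d (\<xi> c)" "d \<notin> charts_at A p \<Longrightarrow> \<xi> d = 0"
      using c unfolding tangent_space_def by blast+
    then show "?\<xi> (\<xi> c) d = \<xi> d" by presburger
  qed
  show "\<forall>v\<in>UNIV. ?\<xi> v c = v" using c transition_self[OF c] by simp
  have "?T d d' (?T c d v) = ?T c d' v" if "d \<in> charts_at A p" "d' \<in> charts_at A p" for d d' v
    using fun_cong[OF local_rep_derivative_change[OF id_in_C1_maps c c that], of v] transition_self[OF c]
    by (simp add: local_rep_def o_def)
  then have "?\<xi> v \<in> tangent_space A p" for v
    unfolding tangent_space_def mem_Collect_eq by (intro conjI allI ballI impI) simp_all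
  then show "?\<xi> ` UNIV \<subseteq> tangent_space A p" by blast
qed simp

text \<open>One pair of charts decides criticality: tangent spaces are identified with the Euclidean
  space, where a linear self-map is bijective once it is injective.\<close>

lemma critical_set_iff:
  assumes g: "g \<in> C1_maps A" and c: "c \<in> charts_at A p" and d: "d \<in> charts_at A (g p)"
  shows "p \<in> critical_set A g \<longleftrightarrow> \<not> inj (frechet_derivative (local_rep c d g) (at (chart_map c p)))"
proof -
  let ?D = "frechet_derivative (local_rep c d g) (at (chart_map c p))"
  have lin: "linear ?D"
    using local_rep_differentiable[OF g c d] by (rule linear_frechet_derivative)
  have "bij_betw (differential A g p) (tangent_space A p) (tangent_space A (g p)) \<longleftrightarrow>
      bij_betw ((\<lambda>\<xi>. \<xi> d) \<circ> differential A g p) (tangent_space A p) UNIV"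
    using differential_in_tangent_space[OF g]
    by (intro bij_betw_comp_iff2[OF bij_betw_tangent_coordinates[OF d]]) blast
  also have "\<dots> \<longleftrightarrow> bij_betw (?D \<circ> (\<lambda>\<xi>. \<xi> c)) (tangent_space A p) UNIV"
    using differential_eq[OF g c d] by (intro bij_betw_cong) simp
  also have "\<dots> \<longleftrightarrow> bij ?D"
    by (rule bij_betw_comp_iff[OF bij_betw_tangent_coordinates[OF c], symmetric])
  also have "\<dots> \<longleftrightarrow> inj ?D"
    using linear_injective_imp_surjective[OF lin] by (auto simp: bij_def)
  finally show ?thesis by (simp add: critical_set_def)
qed

text \<open>Reduces derivatives in arbitrary charts to the fixed pair in which a perturbation is an
  addition. The chart is changed once in the source and once in the target.\<close>

lemma local_rep_derivative_in_charts:
  assumes g: "g \<in> C1_maps A" and c: "c \<in> charts_at A p" "c' \<in> charts_at A p"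
    and d: "d \<in> charts_at A (g p)" "d' \<in> charts_at A (g p)"
  shows "frechet_derivative (local_rep c' d' g) (at (chart_map c' p)) v =
     frechet_derivative (chart_map d' \<circ> chart_inv d) (at (chart_map d (g p)))
       (frechet_derivative (local_rep c d g) (at (chart_map c p))
         (frechet_derivative (chart_map c \<circ> chart_inv c') (at (chart_map c' p)) v))"
  using fun_cong[OF local_rep_derivative_change[OF g c(2,1) d(2,2)], of v] transition_self[OF d(2)]
    fun_cong[OF local_rep_derivative_change[OF g c(1,1) d(1,2)]] transition_self[OF c(1)]
  by simp

section \<open>Returns and distinctness of dense orbits\<close>

lemma dense_orbit_visits:
  fixes U :: "'a set"
  assumes z: "has_dense_orbit g z" and U: "open U" "U \<noteq> {}"
  shows "\<exists>n\<ge>N. (g ^^ n) z \<in> U"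
proof -
  let ?F = "(\<lambda>i. (g ^^ i) z) ` {..<N}"
  \<comment> \<open>Only finitely many orbit points precede time N and \<open>U\<close> is infinite,
    so a nonempty open set remains after deleting them.\<close>
  have "open (U - ?F)" using U(1) by (intro open_Diff finite_imp_closed) auto
  moreover have "U - ?F \<noteq> {}" using infinite_open[OF U] finite_subset[of U ?F] by blast
  ultimately have "(U - ?F) \<inter> forward_orbit g z \<noteq> {}"
    using z open_Int_closure_eq_empty[of "U - ?F" "forward_orbit g z"] unfolding has_dense_orbit_def by auto
  then obtain n where "(g ^^ n) z \<in> U - ?F" unfolding forward_orbit_def by blast
  then show ?thesis by (intro exI[of _ n]) (auto simp: not_less[symmetric])
qed

text \<open>A repetition would confine the orbit to finitely many points, whose complement is open
  and nonempty. Distinctness also lets a small ball around one orbit point avoid finitely many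
  others.\<close>

lemma dense_orbit_inj:
  fixes g :: "'a \<Rightarrow> 'a"
  assumes z: "has_dense_orbit g z" and eq: "(g ^^ i) z = (g ^^ j) z"
  shows "i = j"
proof (rule ccontr)
  have no: False if "i < j" "(g ^^ i) z = (g ^^ j) z" for i j
  proof -
    let ?F = "(\<lambda>k. (g ^^ k) z) ` {..<j}"
    have F: "(g ^^ n) z \<in> ?F" for n
    proof (induction n rule: less_induct)
      case (less n)
      show ?case
      proof (cases "n < j")
        case False
        \<comment> \<open>A time n beyond j can be lowered to n - j + i, which is smaller because i
          < j.\<close>
        then have "(g ^^ n) z = (g ^^ (n - j)) ((g ^^ j) z)" by (simp flip: funpow_add[THEN fun_cong, unfolded o_apply])
        also have "\<dots> = (g ^^ (n - j + i)) z" by (simp add: that(2)[symmetric] funpow_add)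
        finally show ?thesis using less[of "n - j + i"] False that(1) by simp
      qed auto
    qed
    have "open (- ?F)" by (intro open_Compl finite_imp_closed) auto
    moreover have "- ?F \<noteq> {}" using infinite_open[OF open_UNIV] finite_subset[of UNIV ?F] by blast
    ultimately obtain n where "(g ^^ n) z \<in> - ?F" using dense_orbit_visits[OF z] by blast
    then show False using F by blast
  qed
  assume "i \<noteq> j"
  then show False using no[of i j] no[of j i] eq by (metis linorder_neqE_nat)
qed

end

subsection \<open>Perturbing a map inside a chart\<close>

text \<open>\<open>\<delta>\<close> is a uniform margin: image points of the ball may be displaced
  by less than this in the coordinates of d without leaving the chart, so that adding a perturbation
  again defines a map into the manifold.\<close>

locale chart_perturbation = smooth_manifold A
  for A :: "('a::{t2_space, second_countable_topology}, 'e::euclidean_space) chart set" +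
  fixes f :: "'a \<Rightarrow> 'a" and c d :: "('a, 'e) chart" and x0 :: 'e and R \<delta> :: real
  assumes f: "f \<in> C1_maps A" and cA: "c \<in> A" and dA: "d \<in> A"
    and ball_sub: "cball x0 R \<subseteq> chart_map c ` (chart_dom c \<inter> f -` chart_dom d)"
    and room: "x \<in> cball x0 R \<Longrightarrow> norm w < \<delta> \<Longrightarrow> local_rep c d f x + w \<in> chart_map d ` chart_dom d"
    and R: "0 < R" and \<delta>: "0 < \<delta>"
begin

abbreviation V where "V \<equiv> chart_dom c \<inter> f -` chart_dom d"
abbreviation W where "W \<equiv> chart_map c ` V"
abbreviation DF where "DF x \<equiv> frechet_derivative (local_rep c d f) (at x)"
definition "B = chart_inv c ` cball x0 R"
definition "Adm = {s \<in> C1_perturbations x0 R. norm s < \<delta>}"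

text \<open>For admissible s this agrees with f off the closed set \<open>B\<close>. Since
  \<open>V\<close> and the complement of \<open>B\<close> are open and cover the manifold, local
  properties can be checked on these two sets.\<close>

definition perturb :: "('e \<Rightarrow>\<^sub>C 'e) \<times> ('e \<Rightarrow>\<^sub>C 'e \<Rightarrow>\<^sub>L 'e) \<Rightarrow> 'a \<Rightarrow> 'a" where
  "perturb s p =
     (if p \<in> V then chart_inv d (chart_map d (f p) + apply_bcontfun (fst s) (chart_map c p)) else f p)"

lemma continuous_f: "continuous_on UNIV f"
  using f by (simp add: C1_maps_def)

lemma open_V: "open V"
  using chart_facts(1)[OF cA] chart_facts(1)[OF dA] continuous_f by (intro open_Int open_vimage) auto

lemma open_W: "open W"
proof -
  have "chart_dom c \<inter> V = V" by blast
  then show ?thesis using open_chart_image[OF cA open_V] by simp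
qed

lemma chart_inv_W: "x \<in> W \<Longrightarrow> chart_inv c x \<in> V" "x \<in> W \<Longrightarrow> chart_map c (chart_inv c x) = x"
  using chart_facts(5)[OF cA] by auto

lemma compact_B: "compact B"
  unfolding B_def
  by (intro compact_continuous_image continuous_on_subset[OF chart_facts(4)[OF cA]])
    (use ball_sub in auto)

lemma closed_B: "closed B"
  using compact_B by (rule compact_imp_closed)

lemma B_subset_V: "B \<subseteq> V"
  using ball_sub chart_inv_W by (auto simp: B_def)

lemma B_iff: "p \<in> V \<Longrightarrow> p \<in> B \<longleftrightarrow> chart_map c p \<in> cball x0 R"
  using ball_sub chart_inv_W chart_facts(5)[OF cA] by (fastforce simp: B_def)

lemma V_Un_B: "V \<union> - B = UNIV"
  using B_subset_V by blast

lemma AdmD: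
  assumes "s \<in> Adm"
  shows "(apply_bcontfun (fst s) has_derivative blinfun_apply (apply_bcontfun (snd s) x)) (at x)"
    "x \<notin> ball x0 R \<Longrightarrow> apply_bcontfun (fst s) x = 0"
    "norm (apply_bcontfun (fst s) x) < \<delta>"
proof -
  show "(apply_bcontfun (fst s) has_derivative blinfun_apply (apply_bcontfun (snd s) x)) (at x)"
    "x \<notin> ball x0 R \<Longrightarrow> apply_bcontfun (fst s) x = 0"
    using assms C1_perturbationsD unfolding Adm_def by blast+
  have "norm (apply_bcontfun (fst s) x) \<le> norm (fst s)" by (rule norm_bounded)
  also have "\<dots> \<le> norm s" using norm_fst_le[of "fst s" "snd s"] by simp
  finally show "norm (apply_bcontfun (fst s) x) < \<delta>" using assms by (simp add: Adm_def)
qed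

lemma perturb_range:
  assumes s: "s \<in> Adm" and p: "p \<in> V"
  shows "chart_map d (f p) + apply_bcontfun (fst s) (chart_map c p) \<in> chart_map d ` chart_dom d"
proof (cases "chart_map c p \<in> cball x0 R")
  case True
  have "local_rep c d f (chart_map c p) = chart_map d (f p)"
    using p chart_facts(5)[OF cA] by (simp add: local_rep_def)
  then show ?thesis using room[OF True AdmD(3)[OF s]] by metis
next
  case False
  then show ?thesis using AdmD(2)[OF s, of "chart_map c p"] p by auto
qed

lemma perturb_in_chart:
  assumes s: "s \<in> Adm" and p: "p \<in> V"
  shows "perturb s p \<in> chart_dom d"
    "chart_map d (perturb s p) = chart_map d (f p) + apply_bcontfun (fst s) (chart_map c p)"
  using perturb_range[OF assms] p chart_facts(5)[OF dA] by (auto simp: perturb_def)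

lemma perturb_eq_f:
  assumes "s \<in> Adm" "p \<notin> B"
  shows "perturb s p = f p"
proof (cases "p \<in> V")
  case True
  then have "apply_bcontfun (fst s) (chart_map c p) = 0"
    using assms B_iff[OF True] AdmD(2)[OF assms(1), of "chart_map c p"] by auto
  then show ?thesis using True chart_facts(5)[OF dA] by (simp add: perturb_def)
next
  case False
  then show ?thesis unfolding perturb_def by (rule if_not_P)
qed

text \<open>Perturbation and point move together, as continuity on the space of pairs demands; a
  constant \<open>S\<close> gives continuity of a single map.\<close>

lemma tendsto_perturb:
  assumes S: "(S \<longlongrightarrow> s) F" "\<forall>\<^sub>F n in F. S n \<in> Adm" "s \<in> Adm" and P: "(P \<longlongrightarrow> p) F"
  shows "((\<lambda>n. perturb (S n) (P n)) \<longlongrightarrow> perturb s p) F"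
proof (cases "p \<in> V")
  case True
  have ev: "\<forall>\<^sub>F n in F. P n \<in> V" using topological_tendstoD[OF P open_V True] .
  have evd: "\<forall>\<^sub>F n in F. f (P n) \<in> chart_dom d" and evc: "\<forall>\<^sub>F n in F. P n \<in> chart_dom c"
    using ev by (auto elim: eventually_mono)
  have fP: "((\<lambda>n. f (P n)) \<longlongrightarrow> f p) F"
    using continuous_on_tendsto_compose[OF continuous_f P] by simp
  have "((\<lambda>n. chart_map d (f (P n))) \<longlongrightarrow> chart_map d (f p)) F"
    using continuous_on_tendsto_compose[OF chart_facts(3)[OF dA] fP] True evd by blast
  moreover have "((\<lambda>n. chart_map c (P n)) \<longlongrightarrow> chart_map c p) F"
    using continuous_on_tendsto_compose[OF chart_facts(3)[OF cA] P] True evc by blast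
  ultimately have *: "((\<lambda>n. chart_map d (f (P n)) + apply_bcontfun (fst (S n)) (chart_map c (P n)))
      \<longlongrightarrow> chart_map d (f p) + apply_bcontfun (fst s) (chart_map c p)) F"
    by (intro tendsto_add tendsto_apply_bcontfun tendsto_fst[OF S(1)])
  have "((\<lambda>n. chart_inv d (chart_map d (f (P n)) + apply_bcontfun (fst (S n)) (chart_map c (P n))))
      \<longlongrightarrow> chart_inv d (chart_map d (f p) + apply_bcontfun (fst s) (chart_map c p))) F"
  proof (rule continuous_on_tendsto_compose[OF chart_facts(4)[OF dA] *])
    show "\<forall>\<^sub>F n in F. chart_map d (f (P n)) + apply_bcontfun (fst (S n)) (chart_map c (P n))
        \<in> chart_map d ` chart_dom d"
      using ev S(2) by eventually_elim (rule perturb_range)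
  qed (rule perturb_range[OF S(3) True])
  moreover have "\<forall>\<^sub>F n in F. chart_inv d (chart_map d (f (P n)) + apply_bcontfun (fst (S n)) (chart_map c (P n)))
      = perturb (S n) (P n)"
    using ev by eventually_elim (simp add: perturb_def)
  ultimately show ?thesis
    using True Lim_transform_eventually unfolding perturb_def by fastforce
next
  case False
  then have p: "p \<in> - B" using V_Un_B by blast
  have ev: "\<forall>\<^sub>F n in F. P n \<in> - B"
    using topological_tendstoD[OF P _ p] closed_B by (simp add: open_Compl)
  have "((\<lambda>n. f (P n)) \<longlongrightarrow> f p) F"
    using continuous_on_tendsto_compose[OF continuous_f P] by simp
  moreover have "\<forall>\<^sub>F n in F. f (P n) = perturb (S n) (P n)"
    using ev S(2) by eventually_elim (simp add: perturb_eq_f)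
  ultimately show ?thesis
    using perturb_eq_f[OF S(3)] p by (auto intro: Lim_transform_eventually)
qed

lemma tendsto_perturb_iterate:
  assumes S: "(S \<longlongrightarrow> s) F" "\<forall>\<^sub>F n in F. S n \<in> Adm" "s \<in> Adm" and P: "(P \<longlongrightarrow> p) F"
  shows "((\<lambda>n. (perturb (S n) ^^ k) (P n)) \<longlongrightarrow> (perturb s ^^ k) p) F"
  by (induction k) (use P tendsto_perturb[OF S] in simp_all)

lemma continuous_perturb:
  assumes "s \<in> Adm"
  shows "continuous_on UNIV (perturb s)"
  unfolding continuous_on_def using tendsto_perturb[OF tendsto_const _ assms tendsto_ident_at] assms
  by simp

section \<open>The perturbed map and its derivative in coordinates\<close>

lemma local_rep_perturb:
  assumes s: "s \<in> Adm" and x: "x \<in> W"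
  shows "local_rep c d (perturb s) x = local_rep c d f x + apply_bcontfun (fst s) x"
  using perturb_in_chart(2)[OF s chart_inv_W(1)[OF x]] chart_inv_W(2)[OF x] by (simp add: local_rep_def)

lemma Ck_on_local_rep_f: "Ck_on 1 W (local_rep c d f)"
  using f cA dA unfolding C1_maps_def by blast

lemma has_derivative_local_rep_perturb:
  assumes s: "s \<in> Adm" and x: "x \<in> W"
  shows "(local_rep c d (perturb s) has_derivative
    (\<lambda>v. DF x v + blinfun_apply (apply_bcontfun (snd s) x) v)) (at x)"
  by (rule has_derivative_transform_within_open[OF
        has_derivative_add[OF Ck_on_1D(1)[OF Ck_on_local_rep_f x] AdmD(1)[OF s]] open_W x])
    (simp add: local_rep_perturb[OF s])

lemma frechet_derivative_local_rep_perturb: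
  assumes s: "s \<in> Adm" and x: "x \<in> W"
  shows "frechet_derivative (local_rep c d (perturb s)) (at x) =
    (\<lambda>v. DF x v + blinfun_apply (apply_bcontfun (snd s) x) v)"
  using frechet_derivative_at[OF has_derivative_local_rep_perturb[OF assms]] by simp

lemma Ck_on_local_rep_perturb:
  assumes s: "s \<in> Adm"
  shows "Ck_on 1 W (local_rep c d (perturb s))"
proof (rule Ck_on_1I[OF has_derivative_local_rep_perturb[OF s]])
  show "continuous_on W (\<lambda>x. DF x v + blinfun_apply (apply_bcontfun (snd s) x) v)" for v
    by (intro continuous_intros continuous_on_apply_bcontfun Ck_on_1D(2)[OF Ck_on_local_rep_f])
qed

lemma perturb_in_C1_maps:
  assumes s: "s \<in> Adm"
  shows "perturb s \<in> C1_maps A"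
proof -
  let ?g = "perturb s"
  have *: "Ck_on 1 (chart_map c' ` (chart_dom c' \<inter> ?g -` chart_dom d')) (local_rep c' d' ?g)"
    if c': "c' \<in> A" and d': "d' \<in> A" for c' d'
  proof -
    have opn: "open (?g -` chart_dom d')"
      using chart_facts(1)[OF d'] continuous_perturb[OF s] by (rule open_vimage)
    \<comment> \<open>On \<open>S1\<close> the map is read through c and d and composed with
      coordinate changes; on \<open>S2\<close> it is f.\<close>
    define S1 where "S1 = chart_map c' ` (chart_dom c' \<inter> (V \<inter> ?g -` chart_dom d'))"
    define S2 where "S2 = chart_map c' ` (chart_dom c' \<inter> (- B \<inter> ?g -` chart_dom d'))"
    have open12: "open S1" "open S2"
      unfolding S1_def S2_def
      by (intro open_chart_image[OF c'] open_Int open_Compl opn open_V closed_B)+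
    have "Ck_on 1 S2 (local_rep c' d' f)"
      by (rule Ck_on_subset[of _ "chart_map c' ` (chart_dom c' \<inter> f -` chart_dom d')"])
        (use f c' d' perturb_eq_f[OF s] in \<open>auto simp: S2_def C1_maps_def simp del: One_nat_def\<close>)
    then have C2: "Ck_on 1 S2 (local_rep c' d' ?g)"
      by (rule Ck_on_1_cong[OF _ open12(2)])
        (use perturb_eq_f[OF s] chart_facts(5)[OF c'] in \<open>auto simp: S2_def local_rep_def\<close>)
    have "Ck_on 1 S1 (chart_map c \<circ> chart_inv c')"
      by (rule Ck_on_subset[OF transition_C1[OF c' cA]]) (auto simp: S1_def)
    moreover have im1: "(chart_map c \<circ> chart_inv c') ` S1 \<subseteq> W"
      using chart_facts(5)[OF c'] by (auto simp: S1_def)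
    ultimately have "Ck_on 1 S1 (local_rep c d ?g \<circ> (chart_map c \<circ> chart_inv c'))"
      using Ck_on_local_rep_perturb[OF s] Ck_on_1_compose by blast
    moreover have "(local_rep c d ?g \<circ> (chart_map c \<circ> chart_inv c')) ` S1
        \<subseteq> chart_map d ` (chart_dom d \<inter> chart_dom d')"
      using chart_facts(5)[OF c'] chart_facts(5)[OF cA] perturb_in_chart(1)[OF s]
      by (auto simp: S1_def local_rep_def)
    ultimately have "Ck_on 1 S1 ((chart_map d' \<circ> chart_inv d) \<circ> (local_rep c d ?g \<circ> (chart_map c \<circ> chart_inv c')))"
      using transition_C1[OF dA d'] Ck_on_1_compose by blast
    then have C1: "Ck_on 1 S1 (local_rep c' d' ?g)"
      by (rule Ck_on_1_cong[OF _ open12(1)])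
        (use perturb_in_chart(1)[OF s] chart_facts(5)[OF c'] chart_facts(5)[OF cA] chart_facts(5)[OF dA]
          in \<open>auto simp: S1_def local_rep_def\<close>)
    have "chart_map c' ` (chart_dom c' \<inter> ?g -` chart_dom d') = S1 \<union> S2"
      using V_Un_B unfolding S1_def S2_def by blast
    then show ?thesis using Ck_on_1_Un[OF C1 C2 open12] by simp
  qed
  show ?thesis unfolding C1_maps_def mem_Collect_eq
    by (intro conjI ballI continuous_perturb[OF s]) (rule *)
qed

section \<open>Small perturbations lie in C1 neighbourhoods of f\<close>

lemma zero_in_Adm: "0 \<in> Adm"
  using C1_perturbations_zero \<delta> by (simp add: Adm_def)

lemma perturb_zero: "perturb 0 = f"
proof
  fix p show "perturb 0 p = f p"
    using chart_facts(5)[OF dA] unfolding perturb_def by simp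
qed

text \<open>At the limit point p the comparison of f with the centre h is strict, hence it survives
  nearby. The points move with n so that uniformity over a compact set follows by extracting a
  convergent subsequence of bad points.\<close>

lemma eventually_perturb_C1_close:
  assumes h: "h \<in> C1_maps A" and c': "c' \<in> A" and d': "d' \<in> A"
    and T: "T \<longlonglongrightarrow> 0" "\<And>n. T n \<in> Adm"
    and P: "P \<longlonglongrightarrow> p" "\<And>n. P n \<in> B" "\<And>n. P n \<in> chart_dom c'" "\<And>n. h (P n) \<in> chart_dom d'"
    and p: "p \<in> B" "p \<in> chart_dom c'" "h p \<in> chart_dom d'" "f p \<in> chart_dom d'"
    and close: "norm (local_rep c' d' f (chart_map c' p) - local_rep c' d' h (chart_map c' p)) < \<epsilon>"
      "onorm (\<lambda>v. frechet_derivative (local_rep c' d' f) (at (chart_map c' p)) v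
                 - frechet_derivative (local_rep c' d' h) (at (chart_map c' p)) v) < \<epsilon>"
  shows "\<forall>\<^sub>F n in sequentially. perturb (T n) (P n) \<in> chart_dom d' \<and>
     norm (local_rep c' d' (perturb (T n)) (chart_map c' (P n)) - local_rep c' d' h (chart_map c' (P n))) < \<epsilon> \<and>
     onorm (\<lambda>v. frechet_derivative (local_rep c' d' (perturb (T n))) (at (chart_map c' (P n))) v
                 - frechet_derivative (local_rep c' d' h) (at (chart_map c' (P n))) v) < \<epsilon>"
proof -
  let ?g = "\<lambda>n. perturb (T n)"
  have pV: "p \<in> V" and PV: "P n \<in> V" for n using p(1) P(2) B_subset_V by blast+
  have inv': "chart_inv c' (chart_map c' q) = q" if "q \<in> chart_dom c'" for q
    using chart_facts(5)[OF c'] that by blast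
  have g_lim: "(\<lambda>n. ?g n (P n)) \<longlonglongrightarrow> f p"
    using tendsto_perturb[OF T(1) _ zero_in_Adm P(1)] T(2) by (simp add: perturb_zero)
  have ev: "\<forall>\<^sub>F n in sequentially. ?g n (P n) \<in> chart_dom d'"
    using topological_tendstoD[OF g_lim chart_facts(1)[OF d'] p(4)] .
  have h_lim: "(\<lambda>n. h (P n)) \<longlonglongrightarrow> h p"
    using h P(1) by (auto simp: C1_maps_def intro: continuous_on_tendsto_compose)
  have "(\<lambda>n. chart_map d' (?g n (P n))) \<longlonglongrightarrow> chart_map d' (f p)"
    by (rule continuous_on_tendsto_compose[OF chart_facts(3)[OF d'] g_lim p(4) ev])
  moreover have "(\<lambda>n. chart_map d' (h (P n))) \<longlonglongrightarrow> chart_map d' (h p)"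
    by (rule continuous_on_tendsto_compose[OF chart_facts(3)[OF d'] h_lim p(3)]) (simp add: P(4))
  ultimately have "(\<lambda>n. norm (chart_map d' (?g n (P n)) - chart_map d' (h (P n))))
      \<longlonglongrightarrow> norm (chart_map d' (f p) - chart_map d' (h p))"
    by (intro tendsto_intros)
  moreover have "norm (chart_map d' (f p) - chart_map d' (h p)) < \<epsilon>"
    using close(1) inv'[OF p(2)] by (simp add: local_rep_def)
  ultimately have ev0: "\<forall>\<^sub>F n in sequentially. norm (chart_map d' (?g n (P n)) - chart_map d' (h (P n))) < \<epsilon>"
    by (rule order_tendstoD(2))

  have cP: "(\<lambda>n. chart_map c (P n)) \<longlonglongrightarrow> chart_map c p"
    by (rule continuous_on_tendsto_compose[OF chart_facts(3)[OF cA] P(1)]) (use pV PV in auto)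
  have c'P: "(\<lambda>n. chart_map c' (P n)) \<longlonglongrightarrow> chart_map c' p"
    by (rule continuous_on_tendsto_compose[OF chart_facts(3)[OF c'] P(1)]) (use p P in auto)
  have dg: "(\<lambda>n. chart_map d (?g n (P n))) \<longlonglongrightarrow> chart_map d (f p)"
    by (rule continuous_on_tendsto_compose[OF chart_facts(3)[OF dA] g_lim])
      (use pV perturb_in_chart(1)[OF T(2) PV] in auto)
  let ?T1 = "\<lambda>x. frechet_derivative (chart_map c \<circ> chart_inv c') (at x)"
  let ?T2 = "\<lambda>x. frechet_derivative (chart_map d' \<circ> chart_inv d) (at x)"
  \<comment> \<open>\<open>?E n\<close> is the derivative of the perturbed map in the charts c and
    d. Between \<open>?T1\<close> and \<open>?T2\<close> it becomes the derivative in c' and d', and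
    each of the three factors converges.\<close>
  let ?E = "\<lambda>n v. DF (chart_map c (P n)) v + blinfun_apply (apply_bcontfun (snd (T n)) (chart_map c (P n))) v"
  have T1: "(\<lambda>n. ?T1 (chart_map c' (P n)) v) \<longlonglongrightarrow> ?T1 (chart_map c' p) v" for v
    by (rule Ck_on_1_tendsto[OF transition_C1[OF c' cA] c'P]) (use pV PV p P in auto)
  have linE: "linear (?E n)" for n
    using has_derivative_linear[OF has_derivative_local_rep_perturb[OF T(2)]] PV by blast
  have linDF: "linear (DF (chart_map c p))"
    using has_derivative_linear[OF Ck_on_1D(1)[OF Ck_on_local_rep_f]] pV by blast
  have E: "(\<lambda>n. ?E n v) \<longlonglongrightarrow> DF (chart_map c p) v" for v
  proof -
    have "(\<lambda>n. DF (chart_map c (P n)) v) \<longlonglongrightarrow> DF (chart_map c p) v"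
      by (rule Ck_on_1_tendsto[OF Ck_on_local_rep_f cP]) (use pV PV in auto)
    moreover have "(\<lambda>n. apply_bcontfun (snd (T n)) (chart_map c (P n))) \<longlonglongrightarrow> 0"
      using tendsto_apply_bcontfun[OF tendsto_snd[OF T(1)] cP] by simp
    then have "(\<lambda>n. blinfun_apply (apply_bcontfun (snd (T n)) (chart_map c (P n))) v) \<longlonglongrightarrow> blinfun_apply 0 v"
      by (intro tendsto_intros)
    ultimately show ?thesis
      using tendsto_add by (fastforce simp: zero_blinfun.rep_eq)
  qed
  have E': "(\<lambda>n. ?E n (?T1 (chart_map c' (P n)) v)) \<longlonglongrightarrow> DF (chart_map c p) (?T1 (chart_map c' p) v)" for v
    by (rule tendsto_linear_apply[where L = ?E and M = "DF (chart_map c p)"])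
      (use linE linDF E T1 in auto)
  have trans: "(chart_map d' \<circ> chart_inv d has_derivative ?T2 (chart_map d q)) (at (chart_map d q))"
    if "q \<in> chart_dom d" "q \<in> chart_dom d'" for q
    using Ck_on_1D(1)[OF transition_C1[OF dA d']] that by blast
  have T2: "(\<lambda>n. ?T2 (chart_map d (?g n (P n))) (?E n (?T1 (chart_map c' (P n)) v)))
      \<longlonglongrightarrow> ?T2 (chart_map d (f p)) (DF (chart_map c p) (?T1 (chart_map c' p) v))" for v
  proof (rule tendsto_linear_apply[where L = "\<lambda>n. ?T2 (chart_map d (?g n (P n)))" and M = "?T2 (chart_map d (f p))"
        and w = "\<lambda>n. ?E n (?T1 (chart_map c' (P n)) v)"])
    show "\<forall>\<^sub>F n in sequentially. linear (?T2 (chart_map d (?g n (P n))))"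
      using ev by eventually_elim (use trans has_derivative_linear perturb_in_chart(1)[OF T(2) PV] in blast)
    show "linear (?T2 (chart_map d (f p)))"
      using trans has_derivative_linear pV p(4) by blast
    show "(\<lambda>n. ?T2 (chart_map d (?g n (P n))) v) \<longlonglongrightarrow> ?T2 (chart_map d (f p)) v" for v
    proof (rule Ck_on_1_tendsto[OF transition_C1[OF dA d'] dg])
      show "\<forall>\<^sub>F n in sequentially. chart_map d (?g n (P n)) \<in> chart_map d ` (chart_dom d \<inter> chart_dom d')"
        using ev by eventually_elim (use perturb_in_chart(1)[OF T(2) PV] in blast)
    qed (use pV p in auto)
  qed (rule E')
  let ?Dg = "\<lambda>n v. frechet_derivative (local_rep c' d' (?g n)) (at (chart_map c' (P n))) v"
  let ?Dh = "\<lambda>q v. frechet_derivative (local_rep c' d' h) (at (chart_map c' q)) v"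
  \<comment> \<open>The factorisation is claimed for large n, once the image point lies in the
    domain of d'.\<close>
  have Dg_eq: "\<forall>\<^sub>F n in sequentially.
      ?T2 (chart_map d (?g n (P n))) (?E n (?T1 (chart_map c' (P n)) v)) = ?Dg n v" for v
    using ev
  proof eventually_elim
    case (elim n)
    have at: "c \<in> charts_at A (P n)" "c' \<in> charts_at A (P n)"
      "d \<in> charts_at A (?g n (P n))" "d' \<in> charts_at A (?g n (P n))"
      using elim PV[of n] P c' d' cA dA perturb_in_chart(1)[OF T(2) PV] by (auto simp: charts_at_def)
    have "frechet_derivative (local_rep c d (?g n)) (at (chart_map c (P n))) = ?E n"
      by (rule frechet_derivative_local_rep_perturb[OF T(2)]) (use PV in blast)
    then show ?case
      using local_rep_derivative_in_charts[OF perturb_in_C1_maps[OF T(2)] at] by simp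
  qed
  have "c \<in> charts_at A p" "c' \<in> charts_at A p" "d \<in> charts_at A (f p)" "d' \<in> charts_at A (f p)"
    using pV p c' d' cA dA by (auto simp: charts_at_def)
  from local_rep_derivative_in_charts[OF f this] Lim_transform_eventually[OF T2 Dg_eq]
  have "(\<lambda>n. ?Dg n v) \<longlonglongrightarrow> frechet_derivative (local_rep c' d' f) (at (chart_map c' p)) v" for v
    by simp
  moreover have Ch: "Ck_on 1 (chart_map c' ` (chart_dom c' \<inter> h -` chart_dom d')) (local_rep c' d' h)"
    using h c' d' unfolding C1_maps_def by blast
  have "(\<lambda>n. ?Dh (P n) v) \<longlonglongrightarrow> ?Dh p v" for v
    by (rule Ck_on_1_tendsto[OF Ch c'P]) (use p P in auto)
  ultimately have lim: "(\<lambda>n. ?Dg n v - ?Dh (P n) v) \<longlonglongrightarrow>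
      frechet_derivative (local_rep c' d' f) (at (chart_map c' p)) v - ?Dh p v" for v
    by (intro tendsto_diff)
  have linh: "linear (?Dh q)" if "q \<in> chart_dom c'" "h q \<in> chart_dom d'" for q
    using has_derivative_linear[OF Ck_on_1D(1)[OF Ch]] that by blast
  have "\<forall>\<^sub>F n in sequentially. onorm (\<lambda>v. ?Dg n v - ?Dh (P n) v) < \<epsilon>"
  proof (rule eventually_onorm_less[OF _ _ lim close(2)])
    show "\<forall>\<^sub>F n in sequentially. linear (\<lambda>v. ?Dg n v - ?Dh (P n) v)"
      using ev
    proof eventually_elim
      case (elim n)
      have "local_rep c' d' (?g n) differentiable at (chart_map c' (P n))"
        by (rule local_rep_differentiable[OF perturb_in_C1_maps[OF T(2)]])
          (use elim P c' d' in \<open>auto simp: charts_at_def\<close>)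
      then show ?case using linh[OF P(3,4)] linear_frechet_derivative linear_compose_sub by blast
    qed
    have "local_rep c' d' f differentiable at (chart_map c' p)"
      by (rule local_rep_differentiable[OF f]) (use p c' d' in \<open>auto simp: charts_at_def\<close>)
    then show "linear (\<lambda>v. frechet_derivative (local_rep c' d' f) (at (chart_map c' p)) v - ?Dh p v)"
      using linh[OF p(2,3)] linear_frechet_derivative linear_compose_sub by blast
  qed
  with ev ev0 show ?thesis
    by eventually_elim (simp add: local_rep_def inv'[OF P(3)])
qed

text \<open>If it failed, infinitely many indices would have a bad point in the compact set
  \<open>K \<inter> B\<close>; at a limit of these points \<open>eventually_perturb_C1_close\<close>
  gives a contradiction.\<close>

lemma eventually_perturb_in_subbasic:
  assumes h: "h \<in> C1_maps A" and c': "c' \<in> A" and d': "d' \<in> A" and K: "compact K" "K \<subseteq> chart_dom c'"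
    and hK: "h ` K \<subseteq> chart_dom d'" and fU: "f \<in> C1_subbasic A h c' d' K \<epsilon>"
    and S: "S \<longlonglongrightarrow> 0" "\<And>n. S n \<in> Adm"
  shows "\<forall>\<^sub>F n in sequentially. perturb (S n) \<in> C1_subbasic A h c' d' K \<epsilon>"
proof (rule ccontr)
  define good where "good g p \<longleftrightarrow> g p \<in> chart_dom d' \<and>
     norm (local_rep c' d' g (chart_map c' p) - local_rep c' d' h (chart_map c' p)) < \<epsilon> \<and>
     onorm (\<lambda>v. frechet_derivative (local_rep c' d' g) (at (chart_map c' p)) v
                 - frechet_derivative (local_rep c' d' h) (at (chart_map c' p)) v) < \<epsilon>" for g p
  have sub_iff: "g \<in> C1_subbasic A h c' d' K \<epsilon> \<longleftrightarrow> (\<forall>p\<in>K. good g p)" if "g \<in> C1_maps A" for g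
    using that unfolding C1_subbasic_def good_def by blast
  have goodf: "good f p" if "p \<in> K" for p using sub_iff[OF f] fU that by blast
  \<comment> \<open>The complement of \<open>B\<close> is open, so there the derivatives agree with
    those of f as well as the values.\<close>
  have outside: "good (perturb s) p" if s: "s \<in> Adm" and p: "p \<in> K" "p \<notin> B" for s p
  proof -
    have pc: "p \<in> chart_dom c'" using p K by blast
    have fp: "f p \<in> chart_dom d'" using goodf[OF p(1)] by (simp add: good_def)
    have "local_rep c' d' f differentiable at (chart_map c' p)"
      by (rule local_rep_differentiable[OF f]) (use pc fp c' d' in \<open>auto simp: charts_at_def\<close>)
    then have "frechet_derivative (local_rep c' d' f) (at (chart_map c' p)) =
        frechet_derivative (local_rep c' d' (perturb s)) (at (chart_map c' p))"
    proof (rule frechet_derivative_transform_within_open)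
      show "open (chart_map c' ` (chart_dom c' \<inter> - B))"
        by (intro open_chart_image[OF c'] open_Compl closed_B)
      show "local_rep c' d' f y = local_rep c' d' (perturb s) y"
        if "y \<in> chart_map c' ` (chart_dom c' \<inter> - B)" for y
        using that perturb_eq_f[OF s] chart_facts(5)[OF c'] by (auto simp: local_rep_def)
    qed (use p pc in auto)
    moreover have "local_rep c' d' (perturb s) (chart_map c' p) = local_rep c' d' f (chart_map c' p)"
      using perturb_eq_f[OF s p(2)] chart_facts(5)[OF c' pc] by (simp add: local_rep_def)
    ultimately show ?thesis
      using goodf[OF p(1)] perturb_eq_f[OF s p(2)] unfolding good_def by metis
  qed
  assume "\<not> ?thesis"
  then obtain r :: "nat \<Rightarrow> nat" where r: "strict_mono r"
    "\<And>n. perturb (S (r n)) \<notin> C1_subbasic A h c' d' K \<epsilon>"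
    using not_eventually_sequentiallyD by blast
  then have "\<forall>n. \<exists>p. p \<in> K \<inter> B \<and> \<not> good (perturb (S (r n))) p"
    using sub_iff[OF perturb_in_C1_maps[OF S(2)]] outside[OF S(2)] by blast
  then obtain P where P: "\<And>n. P n \<in> K \<inter> B" "\<And>n. \<not> good (perturb (S (r n))) (P n)" by metis
  have "seq_compact (K \<inter> B)"
    using K(1) closed_B by (intro compact_imp_seq_compact compact_Int_closed)
  then obtain p and k :: "nat \<Rightarrow> nat" where p: "p \<in> K \<inter> B" and k: "strict_mono k" "(P \<circ> k) \<longlonglongrightarrow> p"
    using P(1) unfolding seq_compact_def by metis
  have "(S \<circ> (r \<circ> k)) \<longlonglongrightarrow> 0"
    using S(1) r(1) k(1) by (intro LIMSEQ_subseq_LIMSEQ strict_mono_o)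
  then have "\<forall>\<^sub>F n in sequentially. good (perturb ((S \<circ> (r \<circ> k)) n)) ((P \<circ> k) n)"
    unfolding good_def
    by (intro eventually_perturb_C1_close[OF h c' d' _ _ k(2), of "S \<circ> (r \<circ> k)"])
      (use S(2) P(1) p K hK goodf[of p] in \<open>auto simp: good_def\<close>)
  then have "\<exists>n. good (perturb ((S \<circ> (r \<circ> k)) n)) ((P \<circ> k) n)"
    using eventually_happens trivial_limit_sequentially by blast
  then show False using P(2) by auto
qed

text \<open>Being eventually inside passes to binary intersections and to unions, so induction on
  the generation of the topology reduces the claim to subbasic sets.\<close>

lemma eventually_perturb_in_open:
  assumes "openin (C1_topology A) U" "f \<in> U" and S: "S \<longlonglongrightarrow> 0" "\<And>n. S n \<in> Adm"
  shows "\<forall>\<^sub>F n in sequentially. perturb (S n) \<in> U"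
proof -
  let ?\<S> = "{C1_subbasic A f c d K \<epsilon> | f c d K \<epsilon>. f \<in> C1_maps A \<and> c \<in> A \<and> d \<in> A \<and>
        compact K \<and> K \<subseteq> chart_dom c \<and> f ` K \<subseteq> chart_dom d \<and> 0 < \<epsilon>}"
  have "generate_topology_on ?\<S> U"
    using assms(1) unfolding C1_topology_def by (rule openin_topology_generated_by)
  then show ?thesis using assms(2)
  proof induction
    case (Int a b)
    then show ?case by (auto intro: eventually_conj)
  next
    case (UN K)
    then obtain k where "k \<in> K" "f \<in> k" by blast
    with UN.IH[of k] show ?case by (auto elim: eventually_mono)
  next
    case (Basis U)
    then obtain h c' d' K \<epsilon> where U: "U = C1_subbasic A h c' d' K \<epsilon>" "h \<in> C1_maps A" "c' \<in> A" "d' \<in> A"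
        "compact K" "K \<subseteq> chart_dom c'" "h ` K \<subseteq> chart_dom d'" by blast
    show ?case
      using eventually_perturb_in_subbasic[OF U(2-7) _ S] Basis(2) unfolding U(1) by blast
  qed simp
qed

text \<open>Turns the sequential statement into a radius: if none worked, perturbations of norm
  below \<open>\<delta> / Suc n\<close> would form a null sequence staying out of the
  neighbourhood.\<close>

lemma perturb_in_neighborhood:
  assumes "C1_neighborhood A f \<U>"
  obtains \<eta> where "0 < \<eta>" "\<eta> \<le> \<delta>" "\<And>s. s \<in> C1_perturbations x0 R \<Longrightarrow> norm s < \<eta> \<Longrightarrow> perturb s \<in> \<U>"
proof (rule ccontr)
  assume "\<not> thesis"
  then have *: "\<not> (0 < \<eta> \<and> \<eta> \<le> \<delta> \<and> (\<forall>s\<in>C1_perturbations x0 R. norm s < \<eta> \<longrightarrow> perturb s \<in> \<U>))" for \<eta>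
    using that by blast
  have "\<exists>s. s \<in> C1_perturbations x0 R \<and> norm s < \<delta> / Suc n \<and> perturb s \<notin> \<U>" for n
  proof -
    have "\<delta> * 1 \<le> \<delta> * Suc n" using \<delta> by (intro mult_left_mono) auto
    then show ?thesis using *[of "\<delta> / Suc n"] \<delta> by (auto simp: divide_le_eq)
  qed
  then obtain S where S: "\<And>n. S n \<in> C1_perturbations x0 R" "\<And>n. norm (S n) < \<delta> / Suc n" "\<And>n. perturb (S n) \<notin> \<U>"
    by metis
  have "(\<lambda>n. \<delta> / Suc n) \<longlonglongrightarrow> 0"
    using tendsto_mult[OF tendsto_const LIMSEQ_inverse_real_of_nat, of \<delta>] by (simp add: divide_inverse)
  then have lim: "S \<longlonglongrightarrow> 0"
    by (rule Lim_null_comparison[rotated]) (use S(2) less_imp_le in \<open>auto intro!: always_eventually\<close>)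
  have adm: "S n \<in> Adm" for n
  proof -
    have "\<delta> * 1 \<le> \<delta> * Suc n" using \<delta> by (intro mult_left_mono) auto
    then have "\<delta> / Suc n \<le> \<delta>" by (simp add: divide_le_eq)
    then show ?thesis using S(1)[of n] S(2)[of n] unfolding Adm_def by auto
  qed
  obtain U where U: "openin (C1_topology A) U" "f \<in> U" "U \<subseteq> \<U>"
    using assms unfolding C1_neighborhood_def by blast
  have "\<forall>\<^sub>F n in sequentially. perturb (S n) \<in> \<U>"
    using eventually_perturb_in_open[OF U(1,2) lim adm] by (rule eventually_mono) (use U(3) in blast)
  then have "\<exists>n. perturb (S n) \<in> \<U>"
    using eventually_happens trivial_limit_sequentially by blast
  then show False using S(3) by blast
qed

text \<open>As a bounded operator the derivative can be added to the second component of a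
  perturbation, and its continuity is in operator norm. It is meant for x in
  \<open>W\<close>.\<close>

definition "DFB x = Blinfun (DF x)"

lemma blinfun_apply_DFB:
  assumes "x \<in> W"
  shows "blinfun_apply (DFB x) = DF x"
proof -
  have "bounded_linear (DF x)"
    using has_derivative_bounded_linear[OF Ck_on_1D(1)[OF Ck_on_local_rep_f assms]] .
  then show ?thesis unfolding DFB_def by (rule bounded_linear_Blinfun_apply)
qed

lemma continuous_DFB: "continuous_on W DFB"
proof (rule continuous_on_blinfun_componentwise)
  show "continuous_on W (\<lambda>x. blinfun_apply (DFB x) j)" for j
    by (rule continuous_on_eq[OF Ck_on_1D(2)[OF Ck_on_local_rep_f]]) (simp add: blinfun_apply_DFB)
qed

lemma open_coordinate_ball: "open {p \<in> V. chart_map c p \<in> ball y r}"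
proof -
  have "open (V \<inter> chart_map c -` ball y r)"
    using continuous_on_subset[OF chart_facts(3)[OF cA], of V] open_V
    by (intro continuous_open_preimage[OF _ open_V open_ball]) blast
  then show ?thesis by (simp add: vimage_def Int_def conj_ac)
qed

lemma C1_perturbations_mono:
  assumes "ball b q \<subseteq> ball x0 R"
  shows "C1_perturbations b q \<subseteq> C1_perturbations x0 R"
  using C1_perturbations_add[OF C1_perturbations_zero _ assms] by fastforce

subsection \<open>Vanishing differentials\<close>

lemma robustly_transitive_imp_nonzero_derivative:
  assumes "robustly_transitive A f"
  shows "\<exists>v. DF x0 v \<noteq> 0"
proof (rule ccontr)
  assume "\<not> ?thesis"
  then have zero: "DF x0 v = 0" for v by blast
  obtain \<T> where \<T>: "C1_neighborhood A f \<T>" "\<And>g. g \<in> \<T> \<Longrightarrow> transitive_map g"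
    using assms unfolding robustly_transitive_def by blast
  obtain \<eta> where \<eta>: "0 < \<eta>" "\<eta> \<le> \<delta>"
    "\<And>s. s \<in> C1_perturbations x0 R \<Longrightarrow> norm s < \<eta> \<Longrightarrow> perturb s \<in> \<T>"
    using perturb_in_neighborhood[OF \<T>(1)] by blast
  have x0W: "x0 \<in> W" using ball_sub R by auto
  have "DFB x0 = 0"
    using zero blinfun_apply_DFB[OF x0W] by (intro blinfun_eqI) (simp add: zero_blinfun.rep_eq)
  moreover have "isCont DFB x0"
    using continuous_DFB open_W x0W continuous_on_eq_continuous_at by blast
  \<comment> \<open>The 14 exceeds the factor 13 of \<open>cutoff_extension\<close>, so the norm of
    the perturbation stays strictly below \<eta>.\<close>
  ultimately obtain \<theta> where \<theta>: "0 < \<theta>" "\<And>x. dist x x0 < \<theta> \<Longrightarrow> norm (DFB x) < \<eta> / 14"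
    using \<eta>(1) unfolding continuous_at_eps_delta by (metis dist_0_norm dist_commute divide_pos_pos zero_less_numeral)
  define \<rho> where "\<rho> = min (min 1 R) (\<theta> / 2)"
  have \<rho>: "0 < \<rho>" "\<rho> \<le> 1" "\<rho> \<le> R" "\<rho> < \<theta>" using R \<theta>(1) by (auto simp: \<rho>_def)
  have sub: "cball x0 \<rho> \<subseteq> W" using ball_sub \<rho>(3) subset_cball[of \<rho> R x0] by blast
  \<comment> \<open>Adding this difference to the local representation freezes it at its value in
    x0. Its derivative is \<open>- DFB x\<close>, which is small near x0.\<close>
  obtain s where s: "s \<in> C1_perturbations x0 \<rho>" "norm s \<le> 13 * (\<eta> / 14)"
    "\<And>x. x \<in> cball x0 (\<rho> / 2) \<Longrightarrow> apply_bcontfun (fst s) x = local_rep c d f x0 - local_rep c d f x"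
  proof (rule cutoff_extension[of \<rho> x0 "\<lambda>x. local_rep c d f x0 - local_rep c d f x" "\<lambda>x. - DFB x" "\<eta> / 14"])
    show "((\<lambda>x. local_rep c d f x0 - local_rep c d f x) has_derivative blinfun_apply (- DFB x)) (at x)"
      if "x \<in> cball x0 \<rho>" for x
    proof -
      have x: "x \<in> W" using that sub by blast
      show ?thesis
        using has_derivative_diff[OF has_derivative_const Ck_on_1D(1)[OF Ck_on_local_rep_f x]]
        by (simp add: uminus_blinfun.rep_eq blinfun_apply_DFB[OF x] fun_Compl_def)
    qed
    show "continuous_on (cball x0 \<rho>) (\<lambda>x. - DFB x)"
      using continuous_on_subset[OF continuous_DFB sub] by (rule continuous_on_minus)
    show "norm (- DFB x) \<le> \<eta> / 14" if "x \<in> cball x0 \<rho>" for x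
      using \<theta>(2)[of x] that \<rho>(4) by (simp add: dist_commute)
  qed (use \<rho> in auto)
  have sR: "s \<in> C1_perturbations x0 R"
    using s(1) C1_perturbations_mono[of x0 \<rho>] subset_ball[OF \<rho>(3)] by blast
  have norm_s: "norm s < \<eta>" using s(2) \<eta>(1) by simp
  let ?g = "perturb s"
  obtain z where z: "has_dense_orbit ?g z"
    using \<T>(2)[OF \<eta>(3)[OF sR norm_s]] unfolding transitive_map_def by blast
  let ?N = "{p \<in> V. chart_map c p \<in> ball x0 (\<rho> / 2)}"
  have const: "?g p = chart_inv d (local_rep c d f x0)" if "p \<in> ?N" for p
  proof -
    have "apply_bcontfun (fst s) (chart_map c p) = local_rep c d f x0 - local_rep c d f (chart_map c p)"
      using that s(3) by auto
    moreover have "local_rep c d f (chart_map c p) = chart_map d (f p)"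
      using that chart_facts(5)[OF cA] by (auto simp: local_rep_def)
    ultimately show ?thesis using that by (simp add: perturb_def)
  qed
  have "chart_inv c x0 \<in> ?N" using chart_inv_W[OF x0W] \<rho>(1) by auto
  then have N: "open ?N" "?N \<noteq> {}" using open_coordinate_ball by blast+
  obtain m where m: "(?g ^^ m) z \<in> ?N" using dense_orbit_visits[OF z N] by blast
  obtain n where n: "n \<ge> Suc m" "(?g ^^ n) z \<in> ?N" using dense_orbit_visits[OF z N] by blast
  \<comment> \<open>The two visits, at different times, have the same image, so the dense orbit
    repeats.\<close>
  have "(?g ^^ Suc m) z = (?g ^^ Suc n) z" using const[OF m] const[OF n(2)] by simp
  then have "Suc m = Suc n" by (rule dense_orbit_inj[OF z])
  then show False using n(1) by simp
qed

subsection \<open>Critical points with dense orbits\<close>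

text \<open>An affine correction with small linear part \<open>L\<close> can be cut off on an arbitrarily small ball
  without growing in the \<open>C\<^sup>1\<close> norm. Hence a point of a dense orbit close to a critical point can
  be made critical while a prescribed finite piece of its orbit stays untouched.\<close>

lemma critical_point_visits:
  assumes s: "s \<in> C1_perturbations x0 R" and norm_s: "norm s < \<eta>" "\<eta> \<le> \<delta>"
    and trans: "transitive_map (perturb s)"
    and y: "y \<in> ball x0 R" and crit: "\<not> inj (blinfun_apply (DFB y + apply_bcontfun (snd s) y))"
    and e: "0 < e" and O: "open O'" "O' \<noteq> {}"
  obtains t z k where "t \<in> C1_perturbations x0 R" "norm t < \<eta>" "z \<in> ball x0 R"
    "\<not> inj (blinfun_apply (DFB z + apply_bcontfun (snd t) z))"
    "dist (t, z) (s, y) < e" "(perturb t ^^ k) (chart_inv c z) \<in> O'"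
proof -
  let ?g = "perturb s"
  \<comment> \<open>The derivative of the perturbed map in coordinates.\<close>
  define T where "T x = DFB x + apply_bcontfun (snd s) x" for x
  have BW: "ball x0 R \<subseteq> W" using ball_sub by auto
  have "continuous_on (ball x0 R) T"
    unfolding T_def[abs_def]
    by (intro continuous_intros continuous_on_apply_bcontfun continuous_on_subset[OF continuous_DFB BW])
  then have cT: "isCont T y" using y continuous_on_eq_continuous_at[OF open_ball] by blast
  \<comment> \<open>A correction of norm at most 13 * \<epsilon> uses less than half of the distance
    e and keeps the total norm below \<eta>; the other half of e is for moving y to the orbit
    point.\<close>
  define \<epsilon> where "\<epsilon> = min (e / 2) (\<eta> - norm s) / 14"
  have \<epsilon>: "0 < \<epsilon>" "13 * \<epsilon> < e / 2" "norm s + 13 * \<epsilon> < \<eta>"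
    using e norm_s by (auto simp: \<epsilon>_def min_def field_simps)
  obtain \<theta>1 where \<theta>1: "0 < \<theta>1" "\<And>x. dist x y < \<theta>1 \<Longrightarrow> dist (T x) (T y) < \<epsilon>"
    using cT \<epsilon>(1) unfolding continuous_at_eps_delta by metis
  obtain \<theta>2 where \<theta>2: "0 < \<theta>2" "ball y \<theta>2 \<subseteq> ball x0 R"
    by (rule openE[OF open_ball y])
  define \<theta> where "\<theta> = min (min \<theta>1 \<theta>2) (e / 2)"
  have \<theta>: "0 < \<theta>" "\<theta> \<le> \<theta>1" "\<theta> \<le> \<theta>2" "\<theta> \<le> e / 2" using \<theta>1 \<theta>2 e by (auto simp: \<theta>_def)
  obtain z where z: "has_dense_orbit ?g z" using trans unfolding transitive_map_def by blast
  let ?N = "{p \<in> V. chart_map c p \<in> ball y \<theta>}"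
  have "chart_inv c y \<in> ?N" using chart_inv_W[of y] BW y \<theta>(1) by auto
  then obtain m where m: "(?g ^^ m) z \<in> ?N"
    using dense_orbit_visits[OF z open_coordinate_ball[of y \<theta>]] by blast
  obtain n where n: "n \<ge> m" "(?g ^^ n) z \<in> O'" using dense_orbit_visits[OF z O] by blast
  define w where "w = chart_map c ((?g ^^ m) z)"
  have w: "w \<in> ball y \<theta>" "chart_inv c w = (?g ^^ m) z"
    using m chart_facts(5)[OF cA] by (auto simp: w_def)
  have wR: "w \<in> ball x0 R" using w(1) \<theta>2(2) subset_ball[OF \<theta>(3), of y] by blast
  \<comment> \<open>The times are strictly between m and n: at time m the correction vanishes at its
    own centre, and at time n the target is already reached.\<close>
  define Q where "Q = chart_map c ` ((\<lambda>i. (?g ^^ i) z) ` {m<..<n} \<inter> V)"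
  have "w \<notin> Q"
  proof
    assume "w \<in> Q"
    then obtain i where i: "i \<in> {m<..<n}" "(?g ^^ i) z \<in> V" "w = chart_map c ((?g ^^ i) z)"
      unfolding Q_def by blast
    then have "(?g ^^ m) z = (?g ^^ i) z" using chart_facts(5)[OF cA, of "(?g ^^ i) z"] w(2) by simp
    then show False using dense_orbit_inj[OF z] i(1) by auto
  qed
  moreover have "open (ball x0 R - Q)" by (intro open_Diff finite_imp_closed) (auto simp: Q_def)
  ultimately obtain \<rho>0 where \<rho>0: "0 < \<rho>0" "ball w \<rho>0 \<subseteq> ball x0 R - Q"
    using open_contains_ball wR by (metis DiffI)
  define \<rho> where "\<rho> = min 1 \<rho>0"
  have \<rho>: "0 < \<rho>" "\<rho> \<le> 1" "ball w \<rho> \<subseteq> ball x0 R" "ball w \<rho> \<inter> Q = {}"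
    using \<rho>0 by (auto simp: \<rho>_def)
  \<comment> \<open>Adding \<open>L\<close> to the derivative at w turns it into \<open>T y\<close>,
    which is noninvertible; continuity of \<open>T\<close> makes \<open>L\<close> small.\<close>
  define L where "L = T y - T w"
  have "norm L < \<epsilon>" using \<theta>1(2)[of w] w(1) \<theta>(2) by (auto simp: L_def dist_norm norm_minus_commute)
  obtain h where h: "h \<in> C1_perturbations w \<rho>" "norm h \<le> 13 * \<epsilon>"
    "\<And>x. x \<in> cball w (\<rho> / 2) \<Longrightarrow> apply_bcontfun (fst h) x = blinfun_apply L (x - w)"
    "apply_bcontfun (snd h) w = L"
  proof (rule cutoff_extension[of \<rho> w "\<lambda>x. blinfun_apply L (x - w)" "\<lambda>_. L" \<epsilon>])
    show "((\<lambda>x. blinfun_apply L (x - w)) has_derivative blinfun_apply L) (at x)" for x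
      by (auto intro!: derivative_eq_intros)
  qed (use \<rho> \<open>norm L < \<epsilon>\<close> in \<open>auto simp: blinfun.zero_right\<close>)
  let ?t = "s + h"
  have orbit: "(perturb ?t ^^ j) ((?g ^^ m) z) = (?g ^^ (m + j)) z" if "m + j \<le> n" for j
    using that
  proof (induction j)
    case (Suc j)
    let ?p = "(?g ^^ (m + j)) z"
    have "apply_bcontfun (fst h) (chart_map c ?p) = 0" if p: "?p \<in> V"
    proof (cases "j = 0")
      case True
      then show ?thesis using h(3)[of w] \<rho>(1) by (simp add: w_def blinfun.zero_right)
    next
      case False
      then have "m + j \<in> {m<..<n}" using Suc.prems by auto
      then have "chart_map c ?p \<in> Q" using p unfolding Q_def by blast
      then show ?thesis using C1_perturbationsD(2)[OF h(1)] \<rho>(4) by blast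
    qed
    then have "perturb ?t ?p = ?g ?p" by (simp add: perturb_def)
    then show ?case using Suc by simp
  qed simp
  show ?thesis
  proof (rule that[of ?t w "n - m"])
    show "?t \<in> C1_perturbations x0 R" by (rule C1_perturbations_add[OF s h(1) \<rho>(3)])
    show "norm ?t < \<eta>" using norm_triangle_ineq[of s h] h(2) \<epsilon>(3) by linarith
    have "DFB w + apply_bcontfun (snd ?t) w = T y"
      using h(4) by (simp add: L_def T_def)
    then show "\<not> inj (blinfun_apply (DFB w + apply_bcontfun (snd ?t) w))" using crit by (simp add: T_def)
    have "dist (?t, w) (s, y) \<le> norm h + norm (w - y)"
      using norm_Pair_le[of h "w - y"] by (simp add: dist_norm)
    also have "\<dots> < e"
      using h(2) \<epsilon>(2) w(1) \<theta>(4) by (simp add: dist_norm norm_minus_commute)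
    finally show "dist (?t, w) (s, y) < e" .
    show "(perturb ?t ^^ (n - m)) (chart_inv c w) \<in> O'" using orbit[of "n - m"] n w(2) by simp
  qed (rule wR)
qed

lemma dense_critical_orbit:
  assumes crit: "\<not> inj (DF x0)" and rob: "robustly_transitive A f" and \<U>: "C1_neighborhood A f \<U>"
  shows "\<exists>g\<in>\<U>. \<exists>p\<in>critical_set A g. has_dense_orbit g p"
proof -
  obtain \<T> where \<T>: "C1_neighborhood A f \<T>" "\<And>g. g \<in> \<T> \<Longrightarrow> transitive_map g"
    using rob unfolding robustly_transitive_def by blast
  obtain \<eta>1 where \<eta>1: "0 < \<eta>1" "\<eta>1 \<le> \<delta>"
    "\<And>s. s \<in> C1_perturbations x0 R \<Longrightarrow> norm s < \<eta>1 \<Longrightarrow> perturb s \<in> \<T>"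
    using perturb_in_neighborhood[OF \<T>(1)] by blast
  obtain \<eta>2 where \<eta>2: "0 < \<eta>2" "\<eta>2 \<le> \<delta>"
    "\<And>s. s \<in> C1_perturbations x0 R \<Longrightarrow> norm s < \<eta>2 \<Longrightarrow> perturb s \<in> \<U>"
    using perturb_in_neighborhood[OF \<U>] by blast
  \<comment> \<open>The first radius makes every perturbed map transitive, the second puts the map
    finally found into \<U>.\<close>
  define \<eta> where "\<eta> = min \<eta>1 \<eta>2"
  have \<eta>: "0 < \<eta>" "\<eta> \<le> \<eta>1" "\<eta> \<le> \<eta>2" "\<eta> \<le> \<delta>" using \<eta>1 \<eta>2 by (auto simp: \<eta>_def)
  \<comment> \<open>\<open>Z1\<close> is closed in a complete space. The strict bounds in
    \<open>Z\<close>, which leave room to perturb, cut out a relatively open subset, and this is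
    still completely metrizable.\<close>
  define Z1 where "Z1 = {u \<in> C1_perturbations x0 R \<times> cball x0 R.
      \<not> inj (blinfun_apply (DFB (snd u) + apply_bcontfun (snd (fst u)) (snd u)))}"
  define Z where "Z = Z1 \<inter> ball 0 \<eta> \<times> ball x0 R"
  have Z_iff: "(s, y) \<in> Z \<longleftrightarrow> s \<in> C1_perturbations x0 R \<and> norm s < \<eta> \<and> y \<in> ball x0 R \<and>
      \<not> inj (blinfun_apply (DFB y + apply_bcontfun (snd s) y))" for s y
    by (auto simp: Z_def Z1_def)
  have Z_Adm: "fst u \<in> Adm" if "u \<in> Z" for u
    using that Z_iff[of "fst u" "snd u"] \<eta>(4) by (auto simp: Adm_def)
  have "closed Z1"
    unfolding closed_sequential_limits
  proof (intro allI impI)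
    fix X u assume "(\<forall>n. X n \<in> Z1) \<and> X \<longlonglongrightarrow> u"
    then have X: "\<And>n. X n \<in> Z1" and lim: "X \<longlonglongrightarrow> u" by auto
    have "closed (C1_perturbations x0 R \<times> cball x0 R)"
      by (intro closed_Times closed_C1_perturbations closed_cball)
    then have u: "u \<in> C1_perturbations x0 R \<times> cball x0 R"
      using X lim unfolding Z1_def closed_sequential_limits by blast
    have XW: "snd (X n) \<in> W" for n using X[of n] ball_sub by (auto simp: Z1_def)
    have "(\<lambda>n. DFB (snd (X n))) \<longlonglongrightarrow> DFB (snd u)"
      by (rule continuous_on_tendsto_compose[OF continuous_DFB tendsto_snd[OF lim]])
        (use u ball_sub XW in auto)
    moreover have "(\<lambda>n. apply_bcontfun (snd (fst (X n))) (snd (X n))) \<longlonglongrightarrow> apply_bcontfun (snd (fst u)) (snd u)"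
      by (intro tendsto_apply_bcontfun tendsto_fst tendsto_snd lim)
    ultimately have "(\<lambda>n. DFB (snd (X n)) + apply_bcontfun (snd (fst (X n))) (snd (X n))) \<longlonglongrightarrow>
        DFB (snd u) + apply_bcontfun (snd (fst u)) (snd u)"
      by (rule tendsto_add)
    then have "DFB (snd u) + apply_bcontfun (snd (fst u)) (snd u) \<in> {T. \<not> inj (blinfun_apply T)}"
      by (rule closed_sequentially[OF closed_not_inj_blinfun, rotated]) (use X in \<open>auto simp: Z1_def\<close>)
    then show "u \<in> Z1" using u by (simp add: Z1_def)
  qed
  then have "completely_metrizable_space (top_of_set Z1)"
    by (intro completely_metrizable_space_closedin[OF completely_metrizable_space_euclidean])
      (simp add: closed_closedin[symmetric])
  moreover have "openin (top_of_set Z1) Z"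
    unfolding Z_def by (intro openin_open_Int open_Times open_ball)
  ultimately have "completely_metrizable_space (subtopology (top_of_set Z1) Z)"
    by (rule completely_metrizable_space_openin)
  then have cms: "completely_metrizable_space (top_of_set Z)"
    by (simp add: subtopology_subtopology Z_def Int_absorb1)

  define G where "G O' = {u \<in> Z. \<exists>k. (perturb (fst u) ^^ k) (chart_inv c (snd u)) \<in> O'}" for O'
  have cont: "continuous_on Z (\<lambda>u. (perturb (fst u) ^^ k) (chart_inv c (snd u)))" for k
    unfolding continuous_on_def
  proof
    fix u assume u: "u \<in> Z"
    have id: "((\<lambda>u. u) \<longlongrightarrow> u) (at u within Z)" by (rule tendsto_ident_at)
    have inW: "snd u \<in> chart_map c ` chart_dom c" if "u \<in> Z" for u
    proof -
      have "snd u \<in> cball x0 R" using that by (auto simp: Z_def)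
      then show ?thesis using ball_sub by blast
    qed
    show "((\<lambda>u. (perturb (fst u) ^^ k) (chart_inv c (snd u))) \<longlongrightarrow> (perturb (fst u) ^^ k) (chart_inv c (snd u)))
        (at u within Z)"
    proof (rule tendsto_perturb_iterate[OF tendsto_fst[OF id]])
      show "\<forall>\<^sub>F n in at u within Z. fst n \<in> Adm"
        using Z_Adm by (auto simp: eventually_at_filter)
      show "((\<lambda>u. chart_inv c (snd u)) \<longlongrightarrow> chart_inv c (snd u)) (at u within Z)"
        by (rule continuous_on_tendsto_compose[OF chart_facts(4)[OF cA] tendsto_snd[OF id]])
          (use u inW in \<open>auto simp: eventually_at_filter\<close>)
    qed (rule Z_Adm[OF u])
  qed
  have G_open: "openin (top_of_set Z) (G O')" if "open O'" for O'
  proof -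
    define H where "H k = Z \<inter> (\<lambda>u. (perturb (fst u) ^^ k) (chart_inv c (snd u))) -` O'" for k
    have H: "openin (top_of_set Z) (H k)" for k
      unfolding H_def by (rule continuous_openin_preimage_gen[OF cont that])
    have "openin (top_of_set Z) (\<Union>k. H k)" by (rule openin_Union) (use H in blast)
    moreover have "G O' = (\<Union>k. H k)" by (auto simp: G_def H_def)
    ultimately show ?thesis by simp
  qed
  have G_dense: "(top_of_set Z) closure_of G O' = topspace (top_of_set Z)" if O: "open O'" "O' \<noteq> {}" for O'
  proof -
    have "u \<in> (top_of_set Z) closure_of G O'" if u: "u \<in> Z" for u
      unfolding in_closure_of
    proof (intro conjI allI impI)
      show "u \<in> topspace (top_of_set Z)" using u by simp
      fix N assume "u \<in> N \<and> openin (top_of_set Z) N"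
      then have "\<exists>e>0. ball u e \<inter> Z \<subseteq> N" unfolding openin_contains_ball by blast
      then obtain e where e: "0 < e" "ball u e \<inter> Z \<subseteq> N" by metis
      obtain s y where sy: "u = (s, y)" by fastforce
      have Zsy: "s \<in> C1_perturbations x0 R" "norm s < \<eta>" "y \<in> ball x0 R"
        "\<not> inj (blinfun_apply (DFB y + apply_bcontfun (snd s) y))"
        using u Z_iff unfolding sy by blast+
      have "transitive_map (perturb s)" using \<T>(2)[OF \<eta>1(3)[OF Zsy(1)]] Zsy(2) \<eta>(2) by simp
      from critical_point_visits[OF Zsy(1,2) \<eta>(4) this Zsy(3,4) e(1) O]
      obtain t z k where t: "t \<in> C1_perturbations x0 R" "norm t < \<eta>" "z \<in> ball x0 R"
        "\<not> inj (blinfun_apply (DFB z + apply_bcontfun (snd t) z))"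
        "dist (t, z) (s, y) < e" "(perturb t ^^ k) (chart_inv c z) \<in> O'" .
      then have "(t, z) \<in> Z" using Z_iff by blast
      moreover have "(t, z) \<in> ball u e" using t(5) by (simp add: sy dist_commute)
      moreover have "(t, z) \<in> G O'" using t(6) \<open>(t, z) \<in> Z\<close> unfolding G_def by auto
      ultimately show "\<exists>v. v \<in> G O' \<and> v \<in> N" using e(2) by blast
    qed
    then show ?thesis using closure_of_subset_topspace by fastforce
  qed
  obtain \<B> :: "'a set set" where \<B>: "countable \<B>" "topological_basis \<B>"
    using ex_countable_basis by blast
  have "(top_of_set Z) closure_of \<Inter>(G ` (\<B> - {{}})) = topspace (top_of_set Z)"
  proof (rule Baire_category)
    show "openin (top_of_set Z) T \<and> (top_of_set Z) closure_of T = topspace (top_of_set Z)"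
      if "T \<in> G ` (\<B> - {{}})" for T
    proof -
      obtain b where b: "T = G b" "b \<in> \<B>" "b \<noteq> {}" using \<open>T \<in> G ` (\<B> - {{}})\<close> by blast
      have "open b" using topological_basis_open[OF \<B>(2) b(2)] .
      then show ?thesis using G_open G_dense b(3) unfolding b(1) by simp
    qed
    show "countable (G ` (\<B> - {{}}))" using \<B>(1) by (intro countable_image countable_Diff)
  qed (rule disjI1[OF cms])
  moreover have "x0 \<in> W" using ball_sub R by auto
  \<comment> \<open>Criticality of x0 for f makes \<open>Z\<close> nonempty, so the dense
    intersection contains a pair.\<close>
  then have "(0, x0) \<in> Z"
    using crit R \<eta>(1) C1_perturbations_zero by (simp add: Z_iff blinfun_apply_DFB)
  ultimately have "(0, x0) \<in> (top_of_set Z) closure_of \<Inter>(G ` (\<B> - {{}}))" by simp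
  then obtain u where u: "u \<in> \<Inter>(G ` (\<B> - {{}}))" "u \<in> Z"
    using \<open>(0, x0) \<in> Z\<close> unfolding in_closure_of by (metis openin_subtopology_self)
  obtain s y where sy: "u = (s, y)" by fastforce
  have Zsy: "s \<in> C1_perturbations x0 R" "norm s < \<eta>" "y \<in> ball x0 R"
    "\<not> inj (blinfun_apply (DFB y + apply_bcontfun (snd s) y))"
    using u(2) Z_iff unfolding sy by blast+
  have s: "s \<in> Adm" using Z_Adm[OF u(2)] sy by simp
  have yW: "y \<in> W" using Zsy(3) ball_sub by auto
  let ?g = "perturb s" and ?p = "chart_inv c y"
  have at: "c \<in> charts_at A ?p" "d \<in> charts_at A (?g ?p)"
    using chart_inv_W(1)[OF yW] perturb_in_chart(1)[OF s] cA dA by (auto simp: charts_at_def)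
  have "frechet_derivative (local_rep c d ?g) (at (chart_map c ?p)) =
      blinfun_apply (DFB y + apply_bcontfun (snd s) y)"
    using frechet_derivative_local_rep_perturb[OF s yW] chart_inv_W(2)[OF yW]
    by (simp add: fun_eq_iff plus_blinfun.rep_eq blinfun_apply_DFB[OF yW])
  then have "?p \<in> critical_set A ?g"
    using critical_set_iff[OF perturb_in_C1_maps[OF s] at] Zsy(4) by simp
  moreover have "?g \<in> \<U>" using \<eta>2(3)[OF Zsy(1)] Zsy(2) \<eta>(3) by simp
  moreover have "has_dense_orbit ?g ?p"
  proof -
    have "O' \<inter> forward_orbit ?g ?p \<noteq> {}" if O': "open O'" "O' \<noteq> {}" for O'
    proof -
      obtain b where b: "b \<in> \<B>" "b \<noteq> {}" "b \<subseteq> O'"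
        using topological_basisE[OF \<B>(2) O'(1)] O'(2) by (metis empty_iff ex_in_conv)
      then have "u \<in> G b" using u(1) by blast
      then show ?thesis using b(3) unfolding G_def sy forward_orbit_def by auto
    qed
    \<comment> \<open>Were the orbit not dense, the complement of its closure would be a nonempty
      open set that it misses.\<close>
    from this[of "- closure (forward_orbit ?g ?p)"] show ?thesis
      using closure_subset[of "forward_orbit ?g ?p"] unfolding has_dense_orbit_def by blast
  qed
  ultimately show ?thesis by blast
qed

end

section \<open>Suitable charts and the conclusion\<close>

lemma (in smooth_manifold) ex_chart_perturbation:
  assumes f: "f \<in> C1_maps A"
  obtains c d R \<delta> where "chart_perturbation A f c d (chart_map c p) R \<delta>"
    "c \<in> charts_at A p" "d \<in> charts_at A (f p)"
proof -
  obtain c d where c: "c \<in> charts_at A p" and d: "d \<in> charts_at A (f p)"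
    using charts_at_nonempty by blast
  have cA: "c \<in> A" "p \<in> chart_dom c" and dA: "d \<in> A" "f p \<in> chart_dom d"
    using c d by (auto simp: charts_at_def)
  let ?V = "chart_dom c \<inter> f -` chart_dom d" and ?F = "local_rep c d f"
  have "open (f -` chart_dom d)"
    using chart_facts(1)[OF dA(1)] f by (auto simp: C1_maps_def intro: open_vimage)
  then have "open (chart_map c ` ?V)" by (rule open_chart_image[OF cA(1)])
  moreover have "chart_map c p \<in> chart_map c ` ?V" using cA dA by blast
  ultimately obtain R where R: "0 < R" "cball (chart_map c p) R \<subseteq> chart_map c ` ?V"
    using open_contains_cball by blast
  have F: "Ck_on 1 (chart_map c ` ?V) ?F"
    using f cA(1) dA(1) unfolding C1_maps_def by blast
  have "continuous_on (cball (chart_map c p) R) ?F"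
    by (intro continuous_at_imp_continuous_on ballI has_derivative_continuous[OF Ck_on_1D(1)[OF F]])
      (use R(2) in blast)
  then have "compact (?F ` cball (chart_map c p) R)"
    by (rule compact_continuous_image) simp
  moreover have "?F ` cball (chart_map c p) R \<subseteq> chart_map d ` chart_dom d"
    using R(2) chart_facts(5)[OF cA(1)] by (force simp: local_rep_def)
  \<comment> \<open>The image of the closed ball is compact inside the open image of the chart d,
    hence has a uniform margin there.\<close>
  ultimately obtain \<delta> where \<delta>: "0 < \<delta>" "(\<Union>x\<in>?F ` cball (chart_map c p) R. ball x \<delta>) \<subseteq> chart_map d ` chart_dom d"
    using compact_subset_open_imp_ball_epsilon_subset[OF _ chart_facts(2)[OF dA(1)]] by metis
  have "?F x + w \<in> chart_map d ` chart_dom d" if "x \<in> cball (chart_map c p) R" "norm w < \<delta>" for x w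
  proof -
    have "?F x + w \<in> ball (?F x) \<delta>" using that(2) by (simp add: dist_norm)
    then show ?thesis using \<delta>(2) that(1) by blast
  qed
  then have "chart_perturbation A f c d (chart_map c p) R \<delta>"
    using f cA(1) dA(1) R \<delta>(1) by unfold_locales auto
  then show ?thesis using that c d by blast
qed

theorem theorem2:
  fixes A :: "('a::{t2_space, second_countable_topology}, real ^ 2) chart set"
    and f :: "'a \<Rightarrow> 'a"
  assumes "smooth_manifold A"
    and "compact (UNIV :: 'a set)"
    and "f \<in> C1_maps A"
    and "robustly_transitive A f"
    and "persistent_critical_set A f"
  shows "(\<forall>\<U>. C1_neighborhood A f \<U> \<longrightarrow>
            (\<exists>g\<in>\<U>. \<exists>x\<^sub>0\<in>critical_set A g. has_dense_orbit g x\<^sub>0)) \<and>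
         (\<forall>p\<in>critical_set A f. \<not> (\<forall>\<xi>\<in>tangent_space A p. differential A f p \<xi> = (\<lambda>_. 0)))"
proof (intro conjI allI impI ballI)
  interpret smooth_manifold A by fact
  \<comment> \<open>A neighbourhood of f contains f, so persistence applies to f itself.\<close>
  obtain p where p: "p \<in> critical_set A f"
    using assms(5) unfolding persistent_critical_set_def C1_neighborhood_def by blast
  obtain c d R \<delta> where pert: "chart_perturbation A f c d (chart_map c p) R \<delta>"
    and at: "c \<in> charts_at A p" "d \<in> charts_at A (f p)"
    using ex_chart_perturbation[OF assms(3)] .
  show "\<exists>g\<in>\<U>. \<exists>x\<^sub>0\<in>critical_set A g. has_dense_orbit g x\<^sub>0" if "C1_neighborhood A f \<U>" for \<U>
    using chart_perturbation.dense_critical_orbit[OF pert _ assms(4) that]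
      p critical_set_iff[OF assms(3) at] by blast
next
  interpret smooth_manifold A by fact
  fix p
  obtain c d R \<delta> where pert: "chart_perturbation A f c d (chart_map c p) R \<delta>"
    and at: "c \<in> charts_at A p" "d \<in> charts_at A (f p)"
    using ex_chart_perturbation[OF assms(3)] .
  obtain v where v: "frechet_derivative (local_rep c d f) (at (chart_map c p)) v \<noteq> 0"
    using chart_perturbation.robustly_transitive_imp_nonzero_derivative[OF pert assms(4)] by blast
  \<comment> \<open>The coordinate vector v is lifted to a tangent vector, so that nonvanishing in
    coordinates becomes nonvanishing of the differential.\<close>
  obtain \<xi> where \<xi>: "\<xi> \<in> tangent_space A p" "\<xi> c = v"
    using bij_betw_tangent_coordinates[OF at(1)] unfolding bij_betw_def by (metis UNIV_I imageE)
  then have "differential A f p \<xi> d \<noteq> 0"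
    using differential_eq[OF assms(3) at \<xi>(1)] v by simp
  then show "\<not> (\<forall>\<xi>\<in>tangent_space A p. differential A f p \<xi> = (\<lambda>_. 0))"
    using \<xi>(1) by (metis)
qed

end
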